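(* Let $p/q$ be an even rational parameter with $\kappa=0$ and let $p'/q'$ be its even predecessor. Let $\Pi$ and $\Pi'$ be the unions of the plaid polygons with respect to $p/q$ and $p'/q'$ respectively. Let $\omega=p+q$, $\omega'=p'+q'$, and let $\tau'$ be the tune of $p'/q'$. Let $R_{p'/q'}$ be the rectangle bounded by the lines $y=0$, $y=\omega'$, $x=0$ and $x=\min(\tau',\omega'-2\tau')$. Define $\Sigma'$ as follows: if $2\omega'>\omega$ (the weak case), $\Sigma'$ is the subset of $R_{p'/q'}$ bounded above by the line $y=\omega'-\min(\tau',\omega'-2\tau')$; if $2\omega'<\omega$ (the strong case), $\Sigma'=R_{p'/q'}$. Put $\Sigma=\Sigma'$. Then $\Sigma'\cap\Pi'=\Sigma\cap\Pi$.
   Context: Plaid model. An even rational parameter is a rational $p/q\in(0,1)$ in lowest terms with $pq$ even. Put $\omega=p+q$, $P=2p/\omega$, $Q=2q/\omega$. Consider four families of lines: $\mathcal H$ (horizontal lines with integer $y$-coordinate), $\mathcal V$ (vertical lines with integer $x$-coordinate), $\mathcal P$ (slope $-P$, integer $y$-intercept), $\mathcal Q$ (slope $-Q$, integer $y$-intercept). Define functions with values in $\mathbb{R}/2\mathbb{Z}$, represented in $[-1,1)$: $F_H=2Py$, $F_V=2Px$, $F_P=Py+P^2x+1$, $F_Q=Py+PQx+1$. If $z$ is on an $\mathcal A$ line ($A\in\{H,V\}$) and on a $\mathcal B$ line ($B\in\{P,Q\}$), then $z$ is light (for these lines) if $|F_B(z)|<|F_A(z)|$ and $F_A(z)F_B(z)>0$.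 The unit segments are the edges of the unit squares $[a,a+1]\times[b,b+1]$, $a,b\in\mathbb{Z}$. A unit segment contained in an $\mathcal A$ line is good if it contains exactly one point which is light with respect to that $\mathcal A$ line and some $\mathcal P$ or $\mathcal Q$ line, where a light point at the midpoint of a horizontal unit segment is counted twice. It is known that each unit square has $0$ or $2$ good edges. In each unit square with two good edges draw the segments joining the center of the square to the centers of its good edges. The resulting embedded closed polygons are the plaid polygons. Number theory. The tune $\tau$ of $p/q$ is the unique integer in $(0,\omega/2)$ with $2p\tau\equiv\pm1\bmod\omega$ (similarly $\tau'$ for $p'/q'$). The integer $\kappa\ge0$ is determined by $\frac{\kappa}{2\kappa+1}\le\frac{\tau}{\omega}<\frac{\kappa+1}{2(\kappa+1)+1}$. The even predecessor of $p/q$ is the unique even rational $p'/q'$ with $|pq'-p'q|=1$ and $p'+q'<p+q$ (it lies in $(0,1)$ when $\kappa=0$). *)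

theory Defs
  imports "HOL-Analysis.Analysis" "HOL-Number_Theory.Cong"
begin

text \<open>A rational \<open>p/q\<close> in lowest terms is represented by the pair of integers \<open>p\<close>, \<open>q\<close>
  with \<open>q > 0\<close>.\<close>

definition even_rational :: "int \<Rightarrow> int \<Rightarrow> bool" where
  "even_rational p q \<longleftrightarrow> q > 0 \<and> coprime p q \<and> even (p * q)"

definition even_parameter :: "int \<Rightarrow> int \<Rightarrow> bool" where
  "even_parameter p q \<longleftrightarrow> even_rational p q \<and> 0 < p \<and> p < q"

definition tune :: "int \<Rightarrow> int \<Rightarrow> int" where
  "tune p q = (THE t. 0 < t \<and> real_of_int t < real_of_int (p + q) / 2 \<and>
     ([2 * p * t = 1] (mod (p + q)) \<or> [2 * p * t = -1] (mod (p + q))))"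

definition kappa :: "int \<Rightarrow> int \<Rightarrow> nat" where
  "kappa p q = (THE k.
     real k / (2 * real k + 1) \<le> real_of_int (tune p q) / real_of_int (p + q) \<and>
     real_of_int (tune p q) / real_of_int (p + q) < (real k + 1) / (2 * (real k + 1) + 1))"

text \<open>The predecessor is not required to be a parameter: for \<open>p = 1\<close> it is \<open>0/1\<close>.\<close>

definition even_predecessor :: "int \<Rightarrow> int \<Rightarrow> int \<Rightarrow> int \<Rightarrow> bool" where
  "even_predecessor p' q' p q \<longleftrightarrow>
     even_rational p' q' \<and> \<bar>p * q' - p' * q\<bar> = 1 \<and> p' + q' < p + q"

type_synonym point = "real \<times> real"

definition slopeP :: "int \<Rightarrow> int \<Rightarrow> real" where
  "slopeP p q = 2 * real_of_int p / real_of_int (p + q)"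

definition slopeQ :: "int \<Rightarrow> int \<Rightarrow> real" where
  "slopeQ p q = 2 * real_of_int q / real_of_int (p + q)"

definition H_lines :: "point set set" where
  "H_lines = {{(x, y). y = of_int n} | n :: int. True}"

definition V_lines :: "point set set" where
  "V_lines = {{(x, y). x = of_int n} | n :: int. True}"

definition P_lines :: "int \<Rightarrow> int \<Rightarrow> point set set" where
  "P_lines p q = {{(x, y). y = - slopeP p q * x + of_int n} | n :: int. True}"

definition Q_lines :: "int \<Rightarrow> int \<Rightarrow> point set set" where
  "Q_lines p q = {{(x, y). y = - slopeQ p q * x + of_int n} | n :: int. True}"

text \<open>The representative in \<open>[-1, 1)\<close> of the class of \<open>t\<close> modulo \<open>2\<close>.\<close>

definition wrap :: "real \<Rightarrow> real" where
  "wrap t = t - 2 * of_int \<lfloor>(t + 1) / 2\<rfloor>"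

definition F_H :: "int \<Rightarrow> int \<Rightarrow> point \<Rightarrow> real" where
  "F_H p q = (\<lambda>(x, y). wrap (2 * slopeP p q * y))"

definition F_V :: "int \<Rightarrow> int \<Rightarrow> point \<Rightarrow> real" where
  "F_V p q = (\<lambda>(x, y). wrap (2 * slopeP p q * x))"

definition F_P :: "int \<Rightarrow> int \<Rightarrow> point \<Rightarrow> real" where
  "F_P p q = (\<lambda>(x, y). wrap (slopeP p q * y + (slopeP p q)\<^sup>2 * x + 1))"

definition F_Q :: "int \<Rightarrow> int \<Rightarrow> point \<Rightarrow> real" where
  "F_Q p q = (\<lambda>(x, y). wrap (slopeP p q * y + slopeP p q * slopeQ p q * x + 1))"

definition light :: "(point \<Rightarrow> real) \<Rightarrow> point set \<Rightarrow> (point \<Rightarrow> real) \<Rightarrow> point set \<Rightarrow> point \<Rightarrow> bool" where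
  "light FA A FB B z \<longleftrightarrow> z \<in> A \<and> z \<in> B \<and> \<bar>FB z\<bar> < \<bar>FA z\<bar> \<and> FA z * FB z > 0"

definition light_slanted :: "int \<Rightarrow> int \<Rightarrow> (point \<Rightarrow> real) \<Rightarrow> point set \<Rightarrow> point \<Rightarrow> bool" where
  "light_slanted p q FA A z \<longleftrightarrow>
     (\<exists>B \<in> P_lines p q. light FA A (F_P p q) B z) \<or>
     (\<exists>B \<in> Q_lines p q. light FA A (F_Q p q) B z)"

text \<open>The edges of the unit squares, indexed by their left (respectively lower) endpoint.\<close>

datatype edge = HEdge int int | VEdge int int

fun segment :: "edge \<Rightarrow> point set" where
  "segment (HEdge a b) = closed_segment (of_int a, of_int b) (of_int a + 1, of_int b)"
| "segment (VEdge a b) = closed_segment (of_int a, of_int b) (of_int a, of_int b + 1)"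

fun edge_center :: "edge \<Rightarrow> point" where
  "edge_center (HEdge a b) = (of_int a + 1/2, of_int b)"
| "edge_center (VEdge a b) = (of_int a, of_int b + 1/2)"

text \<open>The sum and the cardinality count light points: a point on several slanted lines is one
  point, and a light midpoint of a horizontal edge has weight \<open>2\<close>. Edges are closed, so a light
  lattice point is shared by the two collinear edges ending there. There are only finitely many
  light points on an edge; an infinite set would be counted as \<open>0\<close> and so not be good.\<close>

fun good :: "int \<Rightarrow> int \<Rightarrow> edge \<Rightarrow> bool" where
  "good p q (HEdge a b) \<longleftrightarrow> (\<exists>A \<in> H_lines. segment (HEdge a b) \<subseteq> A \<and>
     (\<Sum>z \<in> {z \<in> segment (HEdge a b). light_slanted p q (F_H p q) A z}.
        if z = edge_center (HEdge a b) then 2 else 1) = (1 :: nat))"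
| "good p q (VEdge a b) \<longleftrightarrow> (\<exists>A \<in> V_lines. segment (VEdge a b) \<subseteq> A \<and>
     card {z \<in> segment (VEdge a b). light_slanted p q (F_V p q) A z} = 1)"

definition square_edges :: "int \<Rightarrow> int \<Rightarrow> edge set" where
  "square_edges a b = {HEdge a b, HEdge a (b + 1), VEdge a b, VEdge (a + 1) b}"

definition square_center :: "int \<Rightarrow> int \<Rightarrow> point" where
  "square_center a b = (of_int a + 1/2, of_int b + 1/2)"

text \<open>The union of all plaid polygons.\<close>

definition plaid :: "int \<Rightarrow> int \<Rightarrow> point set" where
  "plaid p q = \<Union> {closed_segment (square_center a b) (edge_center e) | a b e.
     card {e' \<in> square_edges a b. good p q e'} = 2 \<and> e \<in> square_edges a b \<and> good p q e}"

end

theory Submission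
  imports Defs
begin

text \<open>
  After clearing denominators by \<open>\<omega> = p + q\<close>, every unit edge meets exactly two slanted lines that
  can contribute light points, and the edge is good iff exactly one of these two is light.
  Whether a line with intercept \<open>n\<close> is light depends on the residues of \<open>2pn + \<omega>\<close> and \<open>4pz\<close> modulo
  \<open>2\<omega>\<close>, where \<open>z\<close> is the integer coordinate of the edge.

  For the predecessor, \<open>\<kappa> = 0\<close> gives \<open>\<omega> = \<omega>' + 2\<tau>'\<close> in the weak case and \<open>\<omega> = 3\<omega>' - 2\<tau>'\<close> in the
  strong case. Up to a common sign the two residues \<open>G\<close>, \<open>G'\<close> of a line satisfy
  \<open>\<omega>' G = \<omega> G' + 2n\<close>, so the perturbation can change a sign only if \<open>G'\<close> is small and \<open>n\<close> is large.
  A small \<open>G'\<close> forces \<open>n\<close> to be congruent to a small multiple of \<open>\<tau>'\<close> modulo \<open>\<omega>'\<close>, and the size of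
  the box excludes this. Hence lightness agrees on every edge of the box, except on one horizontal
  level where the capacity is extremal and changes sign; there both lines of an edge change
  their status, so goodness still agrees.

  A polygon may touch the boundary of the box from outside only in the centre of a good edge.
  That this point also belongs to the other plaid set follows because every unit square has \<open>0\<close> or
  \<open>2\<close> good edges, which is a piecewise linear statement in four parameters.
\<close>

section \<open>Balanced residues, capacities and masses\<close>

text \<open>The counterpart of \<open>wrap\<close> for numerators over the common denominator \<open>om\<close>.\<close>

definition bal :: "int \<Rightarrow> int \<Rightarrow> int" where
  "bal om t = (t + om) mod (2 * om) - om"

lemma bal_bounds: "om > 0 \<Longrightarrow> - om \<le> bal om t" "om > 0 \<Longrightarrow> bal om t < om"
  using pos_mod_bound[of "2 * om" "t + om"] by (simp_all add: bal_def)

lemma bal_cong: "[bal om t = t] (mod (2 * om))"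
  by (simp add: bal_def cong_def mod_diff_left_eq)

lemma even_bal: "even (bal om t) \<longleftrightarrow> even t"
  by (auto simp add: bal_def dvd_mod_iff)

lemma wrap_of_int:
  assumes "om > 0"
  shows "wrap (of_int t / of_int om) = of_int (bal om t) / of_int om"
proof -
  have "(of_int t / of_int om + 1) / (2 :: real) = of_int (t + om) / of_int (2 * om)"
    using assms by (simp add: field_simps)
  then have "\<lfloor>(of_int t / of_int om + 1) / (2 :: real)\<rfloor> = (t + om) div (2 * om)"
    by (simp only: floor_divide_of_int_eq)
  moreover have "bal om t = t - 2 * om * ((t + om) div (2 * om))"
    using mod_mult_div_eq[of "t + om" "2 * om"] by (simp add: bal_def algebra_simps)
  then have "real_of_int (bal om t) = of_int t - 2 * of_int om * of_int ((t + om) div (2 * om))"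
    by simp
  ultimately show ?thesis
    using assms by (simp only: wrap_def) (simp add: field_simps)
qed

text \<open>This is \<open>light\<close> after clearing the denominator: equal signs and smaller
  absolute value merge into a condition that depends only on the signs of \<open>G\<close> and
  \<open>F - G\<close>.\<close>

definition lit :: "int \<Rightarrow> int \<Rightarrow> bool" where
  "lit F G \<longleftrightarrow> 0 < G \<and> G < F \<or> F < G \<and> G < 0"

text \<open>Substituting the line equation, both \<open>F_P\<close> and \<open>F_Q\<close> become
  the constant \<open>slopeP p q * n + 1\<close> on a line of intercept \<open>n\<close>, so one
  integer serves both families. The summand \<open>p + q\<close> is the 1 over the common
  denominator.\<close>

definition mass :: "int \<Rightarrow> int \<Rightarrow> int \<Rightarrow> int" where
  "mass p q n = bal (p + q) (2 * p * n + (p + q))"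

definition cap :: "int \<Rightarrow> int \<Rightarrow> int \<Rightarrow> int" where
  "cap p q z = bal (p + q) (4 * p * z)"

lemma lit_iff_real:
  assumes "om > 0"
  shows "(\<bar>of_int G / of_int om\<bar> < \<bar>of_int F / (of_int om :: real)\<bar> \<and>
    of_int F / of_int om * (of_int G / of_int om) > (0 :: real)) \<longleftrightarrow> lit F G"
proof -
  have "\<bar>of_int G / of_int om\<bar> < \<bar>of_int F / (of_int om :: real)\<bar> \<longleftrightarrow> \<bar>G\<bar> < \<bar>F\<bar>"
    using assms by (simp add: divide_less_cancel flip: of_int_abs)
  moreover have "of_int F / of_int om * (of_int G / of_int om) > (0 :: real) \<longleftrightarrow> F * G > 0"
    using assms by (simp add: zero_less_divide_iff zero_less_mult_iff)
  ultimately show ?thesis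
    by (auto simp: lit_def zero_less_mult_iff)
qed

lemma F_H_eq: "p + q > 0 \<Longrightarrow> F_H p q (x, of_int b) = of_int (cap p q b) / of_int (p + q)"
  using wrap_of_int[of "p + q" "4 * p * b"] by (simp add: F_H_def slopeP_def cap_def mult.assoc)

lemma F_V_eq: "p + q > 0 \<Longrightarrow> F_V p q (of_int a, y) = of_int (cap p q a) / of_int (p + q)"
  using wrap_of_int[of "p + q" "4 * p * a"] by (simp add: F_V_def slopeP_def cap_def mult.assoc)

lemma F_P_on_line:
  assumes "p + q > 0" and y: "y = - slopeP p q * x + of_int n"
  shows "F_P p q (x, y) = of_int (mass p q n) / of_int (p + q)"
proof -
  have "slopeP p q * (- slopeP p q * x + of_int n) + (slopeP p q)\<^sup>2 * x + 1
      = slopeP p q * of_int n + 1"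
    by (simp add: algebra_simps power2_eq_square)
  also have "\<dots> = of_int (2 * p * n + (p + q)) / of_int (p + q)"
    using assms(1) by (simp add: slopeP_def add_divide_distrib)
  finally show ?thesis
    using wrap_of_int[OF assms(1), of "2 * p * n + (p + q)"] by (simp add: F_P_def mass_def y)
qed

lemma F_Q_on_line:
  assumes "p + q > 0" and y: "y = - slopeQ p q * x + of_int n"
  shows "F_Q p q (x, y) = of_int (mass p q n) / of_int (p + q)"
proof -
  have "slopeP p q * (- slopeQ p q * x + of_int n) + slopeP p q * slopeQ p q * x + 1
      = slopeP p q * of_int n + 1"
    by (simp add: algebra_simps)
  also have "\<dots> = of_int (2 * p * n + (p + q)) / of_int (p + q)"
    using assms(1) by (simp add: slopeP_def add_divide_distrib)
  finally show ?thesis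
    using wrap_of_int[OF assms(1), of "2 * p * n + (p + q)"] by (simp add: F_Q_def mass_def y)
qed

lemma light_slanted_iff:
  assumes "p + q > 0" "(x, y) \<in> A" "FA (x, y) = of_int c / of_int (p + q)"
  shows "light_slanted p q FA A (x, y) \<longleftrightarrow>
    (\<exists>n. (y = - slopeP p q * x + of_int n \<or> y = - slopeQ p q * x + of_int n) \<and> lit c (mass p q n))"
    (is "?L \<longleftrightarrow> ?R")
proof
  assume ?L
  then show ?R
    unfolding light_slanted_def light_def P_lines_def Q_lines_def
    using assms(3) F_P_on_line[OF assms(1)] F_Q_on_line[OF assms(1)] lit_iff_real[OF assms(1)]
    by fastforce
next
  assume ?R
  then obtain n where
    n: "y = - slopeP p q * x + of_int n \<or> y = - slopeQ p q * x + of_int n" "lit c (mass p q n)"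
    by blast
  from n(1) show ?L
  proof
    assume y: "y = - slopeP p q * x + of_int n"
    then have "(x, y) \<in> {(x, y). y = - slopeP p q * x + of_int n}"
      by simp
    then have "light FA A (F_P p q) {(x, y). y = - slopeP p q * x + of_int n} (x, y)"
      unfolding light_def assms(3) F_P_on_line[OF assms(1) y]
      using assms(2) n(2) lit_iff_real[OF assms(1), of "mass p q n" c] by blast
    then show ?L
      unfolding light_slanted_def P_lines_def by blast
  next
    assume y: "y = - slopeQ p q * x + of_int n"
    then have "(x, y) \<in> {(x, y). y = - slopeQ p q * x + of_int n}"
      by simp
    then have "light FA A (F_Q p q) {(x, y). y = - slopeQ p q * x + of_int n} (x, y)"
      unfolding light_def assms(3) F_Q_on_line[OF assms(1) y]
      using assms(2) n(2) lit_iff_real[OF assms(1), of "mass p q n" c] by blast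
    then show ?L
      unfolding light_slanted_def Q_lines_def by blast
  qed
qed

subsection \<open>Goodness of an edge in terms of two residues\<close>

lemma card_two_candidates:
  assumes "z1 \<noteq> z2"
  shows "card {z. z = z1 \<and> L1 \<or> z = z2 \<and> L2} = 1 \<longleftrightarrow> (L1 \<noteq> L2)"
proof -
  have "{z. z = z1 \<and> L1 \<or> z = z2 \<and> L2} =
      (if L1 then {z1} else {}) \<union> (if L2 then {z2} else {})"
    by auto
  then show ?thesis
    using assms by (auto simp: card_insert_if)
qed

lemma sum_two_candidates:
  assumes "z1 \<noteq> z2" "z1 \<noteq> m" "z2 \<noteq> m"
  shows "(\<Sum>z \<in> {z. z = z1 \<and> L1 \<or> z = z2 \<and> L2}. if z = m then 2 else 1) = (1 :: nat)
    \<longleftrightarrow> (L1 \<noteq> L2)"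
proof -
  have "(\<Sum>z \<in> {z. z = z1 \<and> L1 \<or> z = z2 \<and> L2}. if z = m then 2 else 1) =
      card {z. z = z1 \<and> L1 \<or> z = z2 \<and> L2}"
    using assms(2,3) by (subst card_eq_sum, intro sum.cong) auto
  then show ?thesis
    using card_two_candidates[OF assms(1)] by simp
qed

lemma mem_segment_V:
  "(x, y) \<in> segment (VEdge a b) \<longleftrightarrow> x = of_int a \<and> of_int b \<le> y \<and> y \<le> of_int b + 1"
proof
  assume "(x, y) \<in> segment (VEdge a b)"
  then show "x = of_int a \<and> of_int b \<le> y \<and> y \<le> of_int b + 1"
    by (auto simp: closed_segment_def algebra_simps)
next
  assume "x = of_int a \<and> of_int b \<le> y \<and> y \<le> of_int b + 1"
  then show "(x, y) \<in> segment (VEdge a b)"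
    by (auto simp: closed_segment_def algebra_simps intro!: exI[of _ "y - of_int b"])
qed

lemma mem_segment_H:
  "(x, y) \<in> segment (HEdge a b) \<longleftrightarrow> of_int a \<le> x \<and> x \<le> of_int a + 1 \<and> y = of_int b"
proof
  assume "(x, y) \<in> segment (HEdge a b)"
  then show "of_int a \<le> x \<and> x \<le> of_int a + 1 \<and> y = of_int b"
    by (auto simp: closed_segment_def algebra_simps)
next
  assume "of_int a \<le> x \<and> x \<le> of_int a + 1 \<and> y = of_int b"
  then show "(x, y) \<in> segment (HEdge a b)"
    by (auto simp: closed_segment_def algebra_simps intro!: exI[of _ "x - of_int a"])
qed

lemma ex_V_line:
  "(\<exists>A \<in> V_lines. segment (VEdge a b) \<subseteq> A \<and> \<phi> A) \<longleftrightarrow> \<phi> {(x, y). x = of_int a}"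
proof -
  have *: "segment (VEdge a b) \<subseteq> {(x, y). x = of_int n} \<longleftrightarrow> n = a" for n
    using mem_segment_V[of _ _ a b] mem_segment_V[of "of_int a" "of_int b" a b] by fastforce
  have "(\<exists>A \<in> V_lines. segment (VEdge a b) \<subseteq> A \<and> \<phi> A) \<longleftrightarrow>
      (\<exists>n. segment (VEdge a b) \<subseteq> {(x, y). x = of_int n} \<and> \<phi> {(x, y). x = of_int n})"
    unfolding V_lines_def by blast
  then show ?thesis
    unfolding * by simp
qed

lemma ex_H_line:
  "(\<exists>A \<in> H_lines. segment (HEdge a b) \<subseteq> A \<and> \<phi> A) \<longleftrightarrow> \<phi> {(x, y). y = of_int b}"
proof -
  have *: "segment (HEdge a b) \<subseteq> {(x, y). y = of_int n} \<longleftrightarrow> n = b" for n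
    using mem_segment_H[of _ _ a b] mem_segment_H[of "of_int a" "of_int b" a b] by fastforce
  have "(\<exists>A \<in> H_lines. segment (HEdge a b) \<subseteq> A \<and> \<phi> A) \<longleftrightarrow>
      (\<exists>n. segment (HEdge a b) \<subseteq> {(x, y). y = of_int n} \<and> \<phi> {(x, y). y = of_int n})"
    unfolding H_lines_def by blast
  then show ?thesis
    unfolding * by simp
qed

text \<open>For coprime \<open>p\<close> and \<open>q\<close>, evenness of the product means oddness
  of the sum, and the latter is the form in which parity enters everywhere below.\<close>

definition parameter :: "int \<Rightarrow> int \<Rightarrow> bool" where
  "parameter p q \<longleftrightarrow> 0 < p \<and> p < q \<and> coprime p q \<and> odd (p + q)"

text \<open>\<open>2 * p\<close> is a unit modulo \<open>p + q\<close>: the sum is odd, and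
  \<open>p\<close> is coprime to it because \<open>p\<close> is coprime to \<open>q\<close>.\<close>

lemma parameter_dvd:
  assumes "parameter p q" "p + q dvd 2 * p * n"
  shows "p + q dvd n"
proof -
  have "coprime p (p + q)"
    using assms(1) by (simp add: parameter_def coprime_iff_gcd_eq_1)
  then have "coprime (p + q) p"
    by (rule coprime_commute[THEN iffD1])
  moreover have "coprime (p + q) 2"
    using assms(1) unfolding parameter_def coprime_right_2_iff_odd by blast
  ultimately have "coprime (p + q) (2 * p)"
    by (simp only: coprime_mult_right_iff)
  from coprime_dvd_mult_right_iff[OF this] show ?thesis
    using assms(2) by blast
qed

text \<open>The number of \<open>P\<close> lines that cross the \<open>x\<close>-axis in \<open>(0, a]\<close>.\<close>

definition level :: "int \<Rightarrow> int \<Rightarrow> int \<Rightarrow> int" where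
  "level p q a = 2 * p * a div (p + q)"

lemma slopes_sum: "p + q > 0 \<Longrightarrow> slopeQ p q = 2 - slopeP p q"
proof -
  assume "p + q > 0"
  then have "real_of_int p + real_of_int q > 0"
    by linarith
  then show ?thesis
    by (simp add: slopeP_def slopeQ_def field_simps)
qed

text \<open>The slopes add up to 2, so the fractional part \<open>\<rho>\<close> of
  \<open>P a\<close> locates the crossings of both families. Since \<open>p + q\<close> is odd,
  \<open>\<rho>\<close> is never 1/2, which keeps the P and the Q crossing of a vertical edge
  apart.\<close>

lemma slopes_at:
  assumes "parameter p q"
  obtains \<rho> where "slopeP p q * of_int a = of_int (level p q a) + \<rho>"
    and "slopeQ p q * of_int a = 2 * of_int a - of_int (level p q a) - \<rho>"
    and "0 \<le> \<rho>" "\<rho> < 1" "\<rho> \<noteq> 1/2" "\<rho> = 0 \<longleftrightarrow> p + q dvd a"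
proof -
  define om where "om = p + q"
  have om: "om > 0" "odd om"
    using assms by (auto simp: om_def parameter_def)
  define r where "r = 2 * p * a mod om"
  have r: "0 \<le> r" "r < om" "2 * p * a = om * level p q a + r"
    using om(1) by (simp_all add: r_def level_def flip: om_def)
  have "2 * r \<noteq> om"
    using om(2) by auto
  define \<rho> :: real where "\<rho> = of_int r / of_int om"
  have "real_of_int (2 * p * a) = of_int om * of_int (level p q a) + of_int r"
    unfolding r(3) by simp
  then have P: "slopeP p q * of_int a = of_int (level p q a) + \<rho>"
    unfolding slopeP_def om_def[symmetric] \<rho>_def using om(1) by (simp add: field_simps)
  have "slopeQ p q * of_int a = 2 * of_int a - slopeP p q * of_int a"
    using slopes_sum[of p q] om(1) unfolding om_def by (simp add: left_diff_distrib)
  then have Q: "slopeQ p q * of_int a = 2 * of_int a - of_int (level p q a) - \<rho>"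
    using P by linarith
  have "0 \<le> \<rho>" "\<rho> < 1"
    using om(1) r(1,2) by (simp_all add: \<rho>_def)
  have "\<rho> \<noteq> 1/2"
  proof
    assume "\<rho> = 1/2"
    then have "real_of_int (2 * r) = of_int om"
      using om(1) by (simp add: \<rho>_def field_simps)
    with \<open>2 * r \<noteq> om\<close> show False
      by (simp only: of_int_eq_iff)
  qed
  have "r = 0 \<longleftrightarrow> om dvd 2 * p * a"
    unfolding r_def by (rule dvd_eq_mod_eq_0[symmetric])
  also have "\<dots> \<longleftrightarrow> om dvd a"
    using parameter_dvd[OF assms, of a] dvd_mult[of om a "2 * p"] unfolding om_def by blast
  finally have "\<rho> = 0 \<longleftrightarrow> p + q dvd a"
    using om(1) unfolding \<rho>_def om_def[symmetric] by simp
  show ?thesis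
    by (rule that[OF P Q]) fact+
qed

lemma int_between_zero_two: "real_of_int k > 0 \<Longrightarrow> real_of_int k < 2 \<Longrightarrow> k = 1"
  by linarith

text \<open>For \<open>0 < a\<close> each slanted family meets the vertical line at \<open>a\<close>
  in a translate of the integers, with offset \<open>1 - \<rho>\<close> or \<open>\<rho>\<close> and
  \<open>0 < \<rho> < 1\<close>. Hence every unit edge has exactly one interior candidate per
  family.\<close>

lemma good_V:
  assumes "parameter p q" "0 \<le> a" "a < p + q"
  shows "good p q (VEdge a b) \<longleftrightarrow>
    (lit (cap p q a) (mass p q (b + level p q a + 1)) \<noteq>
     lit (cap p q a) (mass p q (b + 2 * a - level p q a)))"
proof -
  define om where "om = p + q"
  have om: "om > 0" "p + q > 0"
    using assms(1) by (auto simp: om_def parameter_def)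
  define A :: "point set" where "A = {(x, y). x = of_int a}"
  let ?c = "cap p q a"
  define T where "T = {z \<in> segment (VEdge a b). light_slanted p q (F_V p q) A z}"
  have good: "good p q (VEdge a b) \<longleftrightarrow> card T = 1"
    unfolding good.simps ex_V_line T_def A_def ..
  have T: "(x, y) \<in> T \<longleftrightarrow> x = of_int a \<and> of_int b \<le> y \<and> y \<le> of_int b + 1 \<and>
      (\<exists>n. (y = - slopeP p q * x + of_int n \<or> y = - slopeQ p q * x + of_int n) \<and>
        lit ?c (mass p q n))" for x y
  proof (cases "x = of_int a")
    case True
    then have "light_slanted p q (F_V p q) A (x, y) \<longleftrightarrow>
        (\<exists>n. (y = - slopeP p q * x + of_int n \<or> y = - slopeQ p q * x + of_int n) \<and>
          lit ?c (mass p q n))"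
      using F_V_eq[OF om(2), of a y] by (intro light_slanted_iff[OF om(2)]) (simp_all add: A_def)
    then show ?thesis
      unfolding T_def mem_Collect_eq mem_segment_V using True by blast
  next
    case False
    then show ?thesis
      unfolding T_def mem_Collect_eq mem_segment_V by blast
  qed
  show ?thesis
  \<comment> \<open>On the axis \<open>\<rho>\<close> is 0 and the crossings are lattice points, so
    the count of candidates breaks down; but the capacity is 0 there and nothing is light.\<close>
  proof (cases "a = 0")
    case True
    then have "?c = 0"
      using om by (simp add: cap_def bal_def)
    then have "\<not> lit ?c G" for G
      by (auto simp: lit_def)
    then have "T = {}"
      using T by auto
    then show ?thesis
      using good \<open>\<And>G. \<not> lit ?c G\<close> by simp
  next
    case False
    define f where "f = level p q a"
    have "\<not> p + q dvd a"
      using False assms(2,3) zdvd_not_zless[of a "p + q"] by auto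
    then obtain \<rho> where \<rho>: "slopeP p q * of_int a = of_int f + \<rho>"
      "slopeQ p q * of_int a = 2 * of_int a - of_int f - \<rho>" "0 < \<rho>" "\<rho> < 1" "\<rho> \<noteq> 1/2"
      using slopes_at[OF assms(1), of a] unfolding f_def by (smt (verit))
    have P: "(of_int b \<le> y \<and> y \<le> of_int b + 1 \<and> y = - slopeP p q * of_int a + of_int n) \<longleftrightarrow>
        n = b + f + 1 \<and> y = of_int b + 1 - \<rho>" for y n
    proof
      assume "of_int b \<le> y \<and> y \<le> of_int b + 1 \<and> y = - slopeP p q * of_int a + of_int n"
      then have y: "y = of_int n - of_int f - \<rho>" "of_int b \<le> y" "y \<le> of_int b + 1"
        using \<rho>(1) by auto
      then have "n - f - b = 1"
        using \<rho>(3,4) by (intro int_between_zero_two) auto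
      with y(1) show "n = b + f + 1 \<and> y = of_int b + 1 - \<rho>"
        by auto
    next
      assume "n = b + f + 1 \<and> y = of_int b + 1 - \<rho>"
      with \<rho> show "of_int b \<le> y \<and> y \<le> of_int b + 1 \<and> y = - slopeP p q * of_int a + of_int n"
        by simp
    qed
    have Q: "(of_int b \<le> y \<and> y \<le> of_int b + 1 \<and> y = - slopeQ p q * of_int a + of_int n) \<longleftrightarrow>
        n = b + 2 * a - f \<and> y = of_int b + \<rho>" for y n
    proof
      assume "of_int b \<le> y \<and> y \<le> of_int b + 1 \<and> y = - slopeQ p q * of_int a + of_int n"
      then have y: "y = of_int n - 2 * of_int a + of_int f + \<rho>" "of_int b \<le> y" "y \<le> of_int b + 1"
        using \<rho>(2) by auto
      \<comment> \<open>The integer without the summand 1 lies in \<open>(-1, 1)\<close>; the shift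
        brings it into the range of \<open>int_between_zero_two\<close>.\<close>
      then have "n - 2 * a + f - b + 1 = 1"
        using \<rho>(3,4) by (intro int_between_zero_two) auto
      then have "n = b + 2 * a - f"
        by simp
      with y(1) show "n = b + 2 * a - f \<and> y = of_int b + \<rho>"
        by auto
    next
      assume "n = b + 2 * a - f \<and> y = of_int b + \<rho>"
      with \<rho> show "of_int b \<le> y \<and> y \<le> of_int b + 1 \<and> y = - slopeQ p q * of_int a + of_int n"
        by simp
    qed
    have "(x, y) \<in> T \<longleftrightarrow> (x, y) = (of_int a, of_int b + 1 - \<rho>) \<and> lit ?c (mass p q (b + f + 1)) \<or>
        (x, y) = (of_int a, of_int b + \<rho>) \<and> lit ?c (mass p q (b + 2 * a - f))" for x y
    proof -
      have "(x, y) \<in> T \<longleftrightarrow> x = of_int a \<and> (\<exists>n.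
          ((of_int b \<le> y \<and> y \<le> of_int b + 1 \<and> y = - slopeP p q * of_int a + of_int n) \<or>
           (of_int b \<le> y \<and> y \<le> of_int b + 1 \<and> y = - slopeQ p q * of_int a + of_int n)) \<and>
          lit ?c (mass p q n))"
        unfolding T by auto
      then show ?thesis
        unfolding P Q by auto
    qed
    then have T_eq: "T = {z. z = (of_int a, of_int b + 1 - \<rho>) \<and> lit ?c (mass p q (b + f + 1)) \<or>
        z = (of_int a, of_int b + \<rho>) \<and> lit ?c (mass p q (b + 2 * a - f))}"
      by auto
    have "(of_int a :: real, of_int b + 1 - \<rho>) \<noteq> (of_int a, of_int b + \<rho>)"
      using \<rho>(5) by auto
    then show ?thesis
      unfolding good f_def[symmetric] T_eq by (intro card_two_candidates)
  qed
qed

lemma level_Suc: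
  assumes "parameter p q"
  shows "level p q (a + 1) = level p q a \<or> level p q (a + 1) = level p q a + 1"
proof -
  have om: "0 < p + q" "0 < p" "p < q"
    using assms by (auto simp: parameter_def)
  define om where "om = p + q"
  have *: "2 * p * (a + 1) = 2 * p * a + 2 * p"
    by (simp add: algebra_simps)
  have "2 * p * a div om \<le> (2 * p * a + 2 * p) div om"
    using om by (intro zdiv_mono1) (auto simp: om_def)
  moreover have "(2 * p * a + 2 * p) div om \<le> (2 * p * a + om) div om"
    using om by (intro zdiv_mono1) (auto simp: om_def)
  moreover have "(2 * p * a + om) div om = 2 * p * a div om + 1"
    using om by (simp add: om_def)
  ultimately show ?thesis
    unfolding level_def * om_def by linarith
qed

lemma level_bounds:
  assumes "parameter p q" "0 \<le> a"
  shows "0 \<le> level p q a" "level p q a \<le> a"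
proof -
  have om: "0 < p + q" "0 < p" "p < q"
    using assms by (auto simp: parameter_def)
  show "0 \<le> level p q a"
    using om assms(2) by (simp add: level_def pos_imp_zdiv_nonneg_iff)
  have "2 * p * a div (p + q) \<le> (p + q) * a div (p + q)"
    using om assms(2) by (intro zdiv_mono1 mult_right_mono) auto
  then show "level p q a \<le> a"
    using om by (simp add: level_def)
qed

text \<open>The intercepts of the two slanted lines that meet the edge \<open>HEdge a b\<close>. The first is always
  a Q line; the second is a P line iff a P line crosses \<open>y = b\<close> inside the edge.\<close>

definition lower_line :: "int \<Rightarrow> int \<Rightarrow> int \<Rightarrow> int \<Rightarrow> int" where
  "lower_line p q a b = b + 2 * a - level p q a"

definition upper_line :: "int \<Rightarrow> int \<Rightarrow> int \<Rightarrow> int \<Rightarrow> int" where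
  "upper_line p q a b =
    (if level p q (a + 1) = level p q a then b + 2 * a - level p q a + 1 else b + level p q a + 1)"

lemma good_H:
  assumes par: "parameter p q" and a: "0 \<le> a" "2 * a + 1 < p + q"
  shows "good p q (HEdge a b) \<longleftrightarrow>
    (lit (cap p q b) (mass p q (lower_line p q a b)) \<noteq>
     lit (cap p q b) (mass p q (upper_line p q a b)))"
proof -
  define P where "P = slopeP p q"
  define Q where "Q = slopeQ p q"
  define f where "f = level p q a"
  define f' where "f' = level p q (a + 1)"
  let ?c = "cap p q b"
  have om: "p + q > 0" "0 < p" "p < q"
    using par by (auto simp: parameter_def)
  have "\<not> p + q dvd a + 1"
    using a zdvd_not_zless[of "a + 1" "p + q"] by auto
  then obtain \<rho>' where \<rho>': "P * (of_int a + 1) = of_int f' + \<rho>'"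
    "Q * (of_int a + 1) = 2 * (of_int a + 1) - of_int f' - \<rho>'" "0 < \<rho>'" "\<rho>' < 1"
    using slopes_at[OF par, of "a + 1"] unfolding f'_def P_def Q_def
    by (metis less_eq_real_def of_int_add of_int_1)
  have "p + q dvd a \<longleftrightarrow> a = 0"
    using a zdvd_not_zless[of a "p + q"] by (cases "a = 0") simp_all
  then obtain \<rho> where \<rho>: "P * of_int a = of_int f + \<rho>"
    "Q * of_int a = 2 * of_int a - of_int f - \<rho>" "0 \<le> \<rho>" "\<rho> < 1" "\<rho> = 0 \<longleftrightarrow> a = 0"
    using slopes_at[OF par, of a] unfolding f_def P_def Q_def by metis
  have Q_eq: "Q = 2 - P"
    using slopes_sum[OF om(1)] by (simp add: P_def Q_def)
  have P: "0 < P" "P < 1"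
    using om by (simp_all add: P_def slopeP_def divide_less_eq)
  have f': "f' = f \<or> f' = f + 1"
    unfolding f_def f'_def using level_Suc[OF par] .
  have f0: "f = 0" if "a = 0"
    using that by (simp add: f_def level_def)

  have "\<not> p + q dvd 2 * a + 1"
    using a zdvd_not_zless[of "2 * a + 1" "p + q"] by auto
  \<comment> \<open>No candidate may be the midpoint, which has weight 2. A slanted line through it
    would make \<open>p + q\<close> divide \<open>2 * a + 1\<close>, a smaller positive
    number.\<close>
  have no_mid: False if "P * (of_int a + 1/2) = of_int k" for k :: int
  proof -
    have "real_of_int (p * (2 * a + 1)) = of_int (k * (p + q))"
      using that om(1) unfolding P_def slopeP_def by (simp add: field_simps)
    then have "p * (2 * a + 1) = k * (p + q)"
      by (simp only: of_int_eq_iff)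
    then have "2 * p * (2 * a + 1) = (p + q) * (2 * k)"
      by (simp add: algebra_simps)
    then have "p + q dvd 2 * p * (2 * a + 1)"
      by (rule dvdI)
    then show False
      using parameter_dvd[OF par] \<open>\<not> p + q dvd 2 * a + 1\<close> by blast
  qed
  have no_midQ: False if "Q * (of_int a + 1/2) = of_int k" for k :: int
  proof -
    have "P * (of_int a + 1/2) = of_int (2 * a + 1 - k)"
      using that unfolding Q_eq by (simp add: field_simps)
    then show False
      by (rule no_mid)
  qed

  define A :: "point set" where "A = {(x, y). y = of_int b}"
  define T where "T = {z \<in> segment (HEdge a b). light_slanted p q (F_H p q) A z}"
  have good: "good p q (HEdge a b) \<longleftrightarrow>
      (\<Sum>z \<in> T. if z = edge_center (HEdge a b) then 2 else 1) = (1 :: nat)"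
    unfolding good.simps ex_H_line T_def A_def ..
  have T: "(x, y) \<in> T \<longleftrightarrow> y = of_int b \<and> (\<exists>n.
      ((of_int a \<le> x \<and> x \<le> of_int a + 1 \<and> P * x = of_int (n - b)) \<or>
       (of_int a \<le> x \<and> x \<le> of_int a + 1 \<and> Q * x = of_int (n - b))) \<and>
      lit ?c (mass p q n))" for x y
  proof (cases "y = of_int b")
    case True
    then have "light_slanted p q (F_H p q) A (x, y) \<longleftrightarrow>
        (\<exists>n. (y = - slopeP p q * x + of_int n \<or> y = - slopeQ p q * x + of_int n) \<and>
          lit ?c (mass p q n))"
      using F_H_eq[OF om(1), of x b] by (intro light_slanted_iff[OF om(1)]) (simp_all add: A_def)
    moreover have "y = - slopeP p q * x + of_int n \<longleftrightarrow> P * x = of_int (n - b)"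
      "y = - slopeQ p q * x + of_int n \<longleftrightarrow> Q * x = of_int (n - b)" for n
      using True by (auto simp: P_def Q_def)
    ultimately show ?thesis
      unfolding T_def mem_Collect_eq mem_segment_H using True by blast
  next
    case False
    then show ?thesis
      unfolding T_def mem_Collect_eq mem_segment_H by blast
  qed

  have Qpos: "Q > 0"
    using P Q_eq by simp
  have Prange: "of_int f + \<rho> \<le> of_int k \<and> of_int k \<le> of_int f' + \<rho>'"
    if "of_int a \<le> x" "x \<le> of_int a + 1" "P * x = of_int k" for x k
    using mult_left_mono[OF that(1), of P] mult_left_mono[OF that(2), of P] that(3) P \<rho>(1) \<rho>'(1)
    by linarith
  have Qrange: "k = 2 * a - f \<or> k = 2 * a - f + 1 \<and> f' = f"
    if "of_int a \<le> x" "x \<le> of_int a + 1" "Q * x = of_int k" for x k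
  proof -
    have "2 * of_int a - of_int f - \<rho> \<le> of_int k" "of_int k \<le> 2 * (of_int a + 1) - of_int f' - \<rho>'"
      using mult_left_mono[OF that(1), of Q] mult_left_mono[OF that(2), of Q] that(3) Qpos \<rho>(2) \<rho>'(2)
      by linarith+
    then have "real_of_int (2 * a - f - 1) < of_int k" "real_of_int k < of_int (2 * a + 2 - f')"
      using \<rho>(4) \<rho>'(3) by auto
    then have "2 * a - f - 1 < k" "k < 2 * a + 2 - f'"
      by (simp_all only: of_int_less_iff)
    then show ?thesis
      using f' by auto
  qed
  have Q1: "of_int a \<le> of_int (2 * a - f) / Q" "of_int (2 * a - f) / Q \<le> of_int a + 1"
    using Qpos \<rho> \<rho>' f' by (auto simp: field_simps)
  have result: "good p q (HEdge a b) \<longleftrightarrow> (lit ?c (mass p q n1) \<noteq> lit ?c (mass p q n2))"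
    if T_eq: "\<And>x y. (x, y) \<in> T \<longleftrightarrow> (x, y) = (x1, of_int b) \<and> lit ?c (mass p q n1) \<or>
        (x, y) = (x2, of_int b) \<and> lit ?c (mass p q n2)"
      and x: "x1 \<noteq> x2" "Q * x1 = of_int k1" "P * x2 = of_int k2 \<or> Q * x2 = of_int k2"
    for x1 x2 n1 n2 k1 k2
  proof -
    have T': "T = {z. z = (x1, of_int b) \<and> lit ?c (mass p q n1) \<or>
        z = (x2, of_int b) \<and> lit ?c (mass p q n2)}"
      using T_eq by auto
    have "x1 \<noteq> of_int a + 1/2" "x2 \<noteq> of_int a + 1/2"
      using x no_mid no_midQ by blast+
    then show ?thesis
      unfolding good T' using x(1) by (intro sum_two_candidates) auto
  qed
  show ?thesis
  proof (cases "f' = f")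
    case True
    have Q2: "of_int a \<le> of_int (2 * a - f + 1) / Q" "of_int (2 * a - f + 1) / Q \<le> of_int a + 1"
      using Qpos \<rho> \<rho>' True by (auto simp: field_simps)
    \<comment> \<open>A P line touches this edge at most in the corner \<open>(0, b)\<close>, where
      it meets the Q line of the same intercept \<open>b\<close>, so it yields no new
      candidate.\<close>
    have line: "x = 0 \<and> a = 0 \<and> k = 0" if "of_int a \<le> x" "x \<le> of_int a + 1" "P * x = of_int k" for x k
    proof -
      have "k = f"
        using Prange[OF that] True \<rho>(3) \<rho>'(4) by linarith
      then have "\<rho> = 0"
        using Prange[OF that] \<rho>(3) by simp
      then show ?thesis
        using \<rho>(5) f0 that(3) P \<open>k = f\<close> by auto
    qed
    have T_eq: "(x, y) \<in> T \<longleftrightarrow> (x, y) = (of_int (2 * a - f) / Q, of_int b) \<and> lit ?c (mass p q (b + 2 * a - f)) \<or>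
        (x, y) = (of_int (2 * a - f + 1) / Q, of_int b) \<and> lit ?c (mass p q (b + 2 * a - f + 1))" for x y
    proof
      assume "(x, y) \<in> T"
      then obtain n where n: "y = of_int b" "of_int a \<le> x" "x \<le> of_int a + 1"
        "P * x = of_int (n - b) \<or> Q * x = of_int (n - b)" "lit ?c (mass p q n)"
        unfolding T by blast
      then have Qx: "Q * x = of_int (n - b)"
        using line[of x "n - b"] by auto
      then have "x = of_int (n - b) / Q"
        using Qpos by (simp add: field_simps)
      moreover have "n = b + 2 * a - f \<or> n = b + 2 * a - f + 1"
        using Qrange[OF n(2,3) Qx] by auto
      ultimately show "(x, y) = (of_int (2 * a - f) / Q, of_int b) \<and> lit ?c (mass p q (b + 2 * a - f)) \<or>
        (x, y) = (of_int (2 * a - f + 1) / Q, of_int b) \<and> lit ?c (mass p q (b + 2 * a - f + 1))"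
        using n(1,5) by auto
    next
      assume "(x, y) = (of_int (2 * a - f) / Q, of_int b) \<and> lit ?c (mass p q (b + 2 * a - f)) \<or>
        (x, y) = (of_int (2 * a - f + 1) / Q, of_int b) \<and> lit ?c (mass p q (b + 2 * a - f + 1))"
      then show "(x, y) \<in> T"
      proof
        assume "(x, y) = (of_int (2 * a - f) / Q, of_int b) \<and> lit ?c (mass p q (b + 2 * a - f))"
        then show ?thesis
          unfolding T using Q1 Qpos by (intro conjI exI[of _ "b + 2 * a - f"]) simp_all
      next
        assume "(x, y) = (of_int (2 * a - f + 1) / Q, of_int b) \<and> lit ?c (mass p q (b + 2 * a - f + 1))"
        then show ?thesis
          unfolding T using Q2 Qpos by (intro conjI exI[of _ "b + 2 * a - f + 1"]) simp_all
      qed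
    qed
    have "good p q (HEdge a b) \<longleftrightarrow>
        (lit ?c (mass p q (b + 2 * a - f)) \<noteq> lit ?c (mass p q (b + 2 * a - f + 1)))"
    proof (rule result[OF T_eq])
      show "of_int (2 * a - f) / Q \<noteq> of_int (2 * a - f + 1) / Q"
        using Qpos by simp
      show "Q * (of_int (2 * a - f) / Q) = of_int (2 * a - f)"
        using Qpos by simp
      show "P * (of_int (2 * a - f + 1) / Q) = of_int (2 * a - f + 1) \<or>
          Q * (of_int (2 * a - f + 1) / Q) = of_int (2 * a - f + 1)"
        using Qpos by simp
    qed
    then show ?thesis
      using True by (simp add: lower_line_def upper_line_def f_def f'_def)
  next
    case False
    then have ff: "f' = f + 1"
      using f' by auto
    have "a \<noteq> 0"
    proof
      assume "a = 0"
      then show False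
        using f0 ff \<rho>'(1,3) P by simp
    qed
    then have "\<rho> > 0"
      using \<rho>(3,5) by linarith
    have P1: "of_int a \<le> of_int (f + 1) / P" "of_int (f + 1) / P \<le> of_int a + 1"
      using P \<rho> \<rho>' ff by (auto simp: field_simps)
    have line: "k = f + 1" if "of_int a \<le> x" "x \<le> of_int a + 1" "P * x = of_int k" for x k
      using Prange[OF that] ff \<open>\<rho> > 0\<close> \<rho>'(4) by linarith
    \<comment> \<open>At a common point, adding \<open>P x\<close> and \<open>Q x\<close> gives
      \<open>2 * x = 2 * a + 1\<close>, which is the excluded midpoint.\<close>
    have "of_int (2 * a - f) / Q \<noteq> of_int (f + 1) / P"
    proof
      assume eq: "of_int (2 * a - f) / Q = of_int (f + 1) / P"
      define x where "x = of_int (f + 1) / P"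
      have x: "P * x = of_int (f + 1)"
        using P by (simp add: x_def)
      have "Q * x = of_int (2 * a - f)"
        using Qpos unfolding x_def eq[symmetric] by simp
      then have "x = of_int a + 1/2"
        using x unfolding Q_eq by (simp add: algebra_simps)
      then show False
        using no_mid x by blast
    qed
    have T_eq: "(x, y) \<in> T \<longleftrightarrow> (x, y) = (of_int (2 * a - f) / Q, of_int b) \<and> lit ?c (mass p q (b + 2 * a - f)) \<or>
        (x, y) = (of_int (f + 1) / P, of_int b) \<and> lit ?c (mass p q (b + f + 1))" for x y
    proof
      assume "(x, y) \<in> T"
      then obtain n where n: "y = of_int b" "of_int a \<le> x" "x \<le> of_int a + 1"
        "P * x = of_int (n - b) \<or> Q * x = of_int (n - b)" "lit ?c (mass p q n)"
        unfolding T by blast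
      from n(4) show "(x, y) = (of_int (2 * a - f) / Q, of_int b) \<and> lit ?c (mass p q (b + 2 * a - f)) \<or>
        (x, y) = (of_int (f + 1) / P, of_int b) \<and> lit ?c (mass p q (b + f + 1))"
      proof
        assume Px: "P * x = of_int (n - b)"
        then have "n = b + f + 1"
          using line[OF n(2,3) Px] by simp
        moreover have "x = of_int (n - b) / P"
          using Px P by (simp add: field_simps)
        ultimately show ?thesis
          using n(1,5) by auto
      next
        assume Qx: "Q * x = of_int (n - b)"
        then have "n = b + 2 * a - f"
          using Qrange[OF n(2,3) Qx] False by auto
        moreover have "x = of_int (n - b) / Q"
          using Qx Qpos by (simp add: field_simps)
        ultimately show ?thesis
          using n(1,5) by auto
      qed
    next
      assume "(x, y) = (of_int (2 * a - f) / Q, of_int b) \<and> lit ?c (mass p q (b + 2 * a - f)) \<or>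
        (x, y) = (of_int (f + 1) / P, of_int b) \<and> lit ?c (mass p q (b + f + 1))"
      then show "(x, y) \<in> T"
      proof
        assume "(x, y) = (of_int (2 * a - f) / Q, of_int b) \<and> lit ?c (mass p q (b + 2 * a - f))"
        then show ?thesis
          unfolding T using Q1 Qpos by (intro conjI exI[of _ "b + 2 * a - f"]) simp_all
      next
        assume "(x, y) = (of_int (f + 1) / P, of_int b) \<and> lit ?c (mass p q (b + f + 1))"
        then show ?thesis
          unfolding T using P1 P by (intro conjI exI[of _ "b + f + 1"]) simp_all
      qed
    qed
    have "good p q (HEdge a b) \<longleftrightarrow>
        (lit ?c (mass p q (b + 2 * a - f)) \<noteq> lit ?c (mass p q (b + f + 1)))"
    proof (rule result[OF T_eq])
      show "of_int (2 * a - f) / Q \<noteq> of_int (f + 1) / P"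
        by fact
      show "Q * (of_int (2 * a - f) / Q) = of_int (2 * a - f)"
        using Qpos by simp
      show "P * (of_int (f + 1) / P) = of_int (f + 1) \<or> Q * (of_int (f + 1) / P) = of_int (f + 1)"
        using P by simp
    qed
    then show ?thesis
      using False by (simp add: lower_line_def upper_line_def f_def f'_def)
  qed
qed

subsection \<open>Every unit square has 0 or 2 good edges\<close>

text \<open>Converts a congruence into a finite case split for linear arithmetic: \<open>y\<close>
  ranges over two periods, so only two shifts can bring it into the window of
  \<open>x\<close>.\<close>

lemma cong_window:
  fixes h x y m :: int
  assumes "[x = y] (mod (2 * h))" "- h \<le> x" "x < h" "(2 * m - 1) * h \<le> y" "y < (2 * m + 3) * h"
  shows "x = y - 2 * m * h \<or> x = y - 2 * (m + 1) * h"
proof -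
  from assms(1) obtain k where k: "y - x = 2 * h * k"
    using cong_iff_dvd_diff cong_sym dvdE by metis
  have "h > 0"
    using assms(2,3) by simp
  have "2 * h * (m - 1) < 2 * h * k" "2 * h * k < 2 * h * (m + 2)"
    using assms(2-5) k by (auto simp: algebra_simps)
  then have "m - 1 < k" "k < m + 2"
    using \<open>h > 0\<close> by (simp_all only: mult_less_cancel_left_pos)
  then have "k = m \<or> k = m + 1"
    by linarith
  then show ?thesis
    using k by (auto simp: algebra_simps)
qed

lemma cong_window4:
  fixes h x y :: int
  assumes "[x = y] (mod (2 * h))" "- h \<le> x" "x < h" "- 3 * h \<le> y" "y < 5 * h"
  shows "x = y - 4 * h \<or> x = y - 2 * h \<or> x = y \<or> x = y + 2 * h"
proof (cases "y < h")
  case True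
  then show ?thesis
    using cong_window[of x y h "- 1"] assms by auto
next
  case False
  then show ?thesis
    using cong_window[of x y h 1] assms by auto
qed

text \<open>Both lemmas describe a square \<open>(a, b)\<close> with \<open>h = p + q\<close> and \<open>P = 2p\<close>. In the first, one P line
  runs from the left to the right edge and \<open>A\<close>, \<open>B\<close>, \<open>g2\<close> are the capacities and the mass at the centre.
  In the second, the lines cut off two opposite corners of the square.\<close>

lemma even_square_core:
  fixes h P A B :: int
  assumes "0 < P" "P < h" "P \<le> A" "A < 2 * h - P"
    and "-h \<le> B" "B < h" "-h \<le> g2" "g2 < h" "g2 \<noteq> 0"
    and "[g1 = g2 - P] (mod (2 * h))" "-h \<le> g1" "g1 < h" "g1 \<noteq> 0"
    and "[g3 = g2 + P] (mod (2 * h))" "-h \<le> g3" "g3 < h" "g3 \<noteq> 0"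
    and "[g4 = A + B - g2] (mod (2 * h))" "-h \<le> g4" "g4 < h" "g4 \<noteq> 0"
    and "[fL = A - P] (mod (2 * h))" "-h \<le> fL" "fL < h"
    and "[fR = A + P] (mod (2 * h))" "-h \<le> fR" "fR < h"
    and "[fB = B - P] (mod (2 * h))" "-h \<le> fB" "fB < h"
    and "[fT = B + P] (mod (2 * h))" "-h \<le> fT" "fT < h"
    and "fL \<noteq> g4" "fL \<noteq> g1" "fR \<noteq> g4" "fR \<noteq> g3" "fB \<noteq> g1" "fB \<noteq> g2" "fT \<noteq> g2" "fT \<noteq> g3"
    and "gL = (lit fL g4 \<noteq> lit fL g1)" "gR = (lit fR g4 \<noteq> lit fR g3)"
    and "gB = (lit fB g1 \<noteq> lit fB g2)" "gT = (lit fT g2 \<noteq> lit fT g3)"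
  shows "((gL = gR) = (gB = gT)) \<and> \<not> (gL \<and> gR \<and> gB \<and> gT)"
proof -
  \<comment> \<open>Each residue becomes one of a few affine functions of \<open>h\<close>,
    \<open>P\<close>, \<open>A\<close>, \<open>B\<close> and \<open>g2\<close>, after which the
    claim is a case analysis in linear arithmetic.\<close>
  have "g1 = g2 - P \<or> g1 = g2 - P + 2 * h"
    using cong_window[of g1 "g2 - P" h "- 1"] assms by auto
  moreover have "g3 = g2 + P \<or> g3 = g2 + P - 2 * h"
    using cong_window[of g3 "g2 + P" h 0] assms by simp
  moreover have "g4 = A + B - g2 - 4 * h \<or> g4 = A + B - g2 - 2 * h \<or> g4 = A + B - g2 \<or>
      g4 = A + B - g2 + 2 * h"
    using cong_window4[of g4 "A + B - g2" h] assms by simp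
  moreover have "fL = A - P \<or> fL = A - P - 2 * h"
    using cong_window[of fL "A - P" h 0] assms by simp
  moreover have "fR = A + P \<or> fR = A + P - 2 * h"
    using cong_window[of fR "A + P" h 0] assms by simp
  moreover have "fB = B - P \<or> fB = B - P + 2 * h"
    using cong_window[of fB "B - P" h "- 1"] assms by auto
  moreover have "fT = B + P \<or> fT = B + P - 2 * h"
    using cong_window[of fT "B + P" h 0] assms by simp
  ultimately show ?thesis
    using assms(1-9,11-13,15-17,19-21,23,24,26,27,29,30,32-) unfolding lit_def by (smt (verit))
qed

lemma odd_square_core:
  fixes h P A B :: int
  assumes "0 < P" "P < h" "2 * (h - P) < A" "A < 2 * h"
    and "-h \<le> fB" "fB < h" "-h \<le> g1" "g1 < h" "g1 \<noteq> 0"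
    and "[g2 = g1 + P] (mod (2 * h))" "-h \<le> g2" "g2 < h" "g2 \<noteq> 0"
    and "[g3 = A + fB + P - g1] (mod (2 * h))" "-h \<le> g3" "g3 < h" "g3 \<noteq> 0"
    and "[g4 = g3 + P] (mod (2 * h))" "-h \<le> g4" "g4 < h" "g4 \<noteq> 0"
    and "[fL = A] (mod (2 * h))" "-h \<le> fL" "fL < h"
    and "[fR = A + 2 * P] (mod (2 * h))" "-h \<le> fR" "fR < h"
    and "[fT = fB + 2 * P] (mod (2 * h))" "-h \<le> fT" "fT < h"
    and "fL \<noteq> g1" "fL \<noteq> g3" "fR \<noteq> g2" "fR \<noteq> g4" "fB \<noteq> g1" "fB \<noteq> g3" "fT \<noteq> g2" "fT \<noteq> g4"
    and "gL = (lit fL g3 \<noteq> lit fL g1)" "gR = (lit fR g4 \<noteq> lit fR g2)"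
    and "gB = (lit fB g1 \<noteq> lit fB g3)" "gT = (lit fT g2 \<noteq> lit fT g4)"
  shows "((gL = gR) = (gB = gT)) \<and> \<not> (gL \<and> gR \<and> gB \<and> gT)"
proof -
  have "g2 = g1 + P \<or> g2 = g1 + P - 2 * h"
    using cong_window[of g2 "g1 + P" h 0] assms by simp
  moreover have "g4 = g3 + P \<or> g4 = g3 + P - 2 * h"
    using cong_window[of g4 "g3 + P" h 0] assms by simp
  moreover have "g3 = A + fB + P - g1 - 4 * h \<or> g3 = A + fB + P - g1 - 2 * h \<or> g3 = A + fB + P - g1 \<or>
      g3 = A + fB + P - g1 + 2 * h"
    using cong_window4[of g3 "A + fB + P - g1" h] assms by simp
  moreover have "fL = A \<or> fL = A - 2 * h"
    using cong_window[of fL A h 0] assms by simp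
  moreover have "fR = A + 2 * P - 2 * h \<or> fR = A + 2 * P - 4 * h"
    using cong_window[of fR "A + 2 * P" h 1] assms by simp
  moreover have "fT = fB + 2 * P \<or> fT = fB + 2 * P - 2 * h"
    using cong_window[of fT "fB + 2 * P" h 0] assms by simp
  ultimately show ?thesis
    using assms(1-9,11-13,15-17,19-21,23,24,26,27,29-) unfolding lit_def by (smt (verit))
qed

text \<open>With explicit representatives and the quotient \<open>k\<close> supplied, a congruence
  between residues is reduced to a polynomial identity.\<close>

lemma cong_via:
  fixes x y s t :: int
  assumes "[x = s] (mod m)" "[y = t] (mod m)" "t = s + m * k"
  shows "[x = y] (mod m)"
proof -
  have "[s = t] (mod m)"
    unfolding cong_iff_lin using assms(3) by (rule exI)
  with assms(1) have "[x = t] (mod m)"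
    by (rule cong_trans)
  from cong_trans[OF this cong_sym[OF assms(2)]] show ?thesis .
qed

lemma div_interval:
  fixes h x :: int
  assumes "h > 0"
  shows "h * (x div h) \<le> x" "x < h * (x div h + 1)"
  using pos_mod_bound[OF assms, of x] pos_mod_sign[OF assms, of x] mod_mult_div_eq[of x h]
  unfolding distrib_left by linarith+

lemma card_filter_insert:
  assumes "finite A" "x \<notin> A"
  shows "card {e \<in> insert x A. \<phi> e} = of_bool (\<phi> x) + card {e \<in> A. \<phi> e}"
proof (cases "\<phi> x")
  case True
  then have "{e \<in> insert x A. \<phi> e} = insert x {e \<in> A. \<phi> e}"
    by blast
  then show ?thesis
    using assms True by simp
next
  case False
  then have "{e \<in> insert x A. \<phi> e} = {e \<in> A. \<phi> e}"
    by blast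
  then show ?thesis
    using False by simp
qed

text \<open>The equation between the two comparisons says that the number of true values is even;
  excluding four leaves 0 and 2.\<close>

lemma card_of_four:
  assumes "distinct [e1, e2, e3, e4]"
    and "((\<phi> e3 = \<phi> e4) = (\<phi> e1 = \<phi> e2)) \<and> \<not> (\<phi> e3 \<and> \<phi> e4 \<and> \<phi> e1 \<and> \<phi> e2)"
  shows "card {e \<in> {e1, e2, e3, e4}. \<phi> e} \<in> {0, 2}"
proof -
  have "card {e \<in> {e1, e2, e3, e4}. \<phi> e} =
      of_bool (\<phi> e1) + (of_bool (\<phi> e2) + (of_bool (\<phi> e3) + of_bool (\<phi> e4)))"
    using assms(1) by (simp add: card_filter_insert del: insert_iff)
  then show ?thesis
    using assms(2) by (cases "\<phi> e1"; cases "\<phi> e2"; cases "\<phi> e3"; cases "\<phi> e4") simp_all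
qed

lemma card_good_square:
  assumes par: "parameter p q" and a: "0 \<le> a" "2 * a + 1 < p + q"
  shows "card {e \<in> square_edges a b. good p q e} \<in> {0, 2}"
  unfolding square_edges_def
proof (rule card_of_four)
  show "distinct [HEdge a b, HEdge a (b + 1), VEdge a b, VEdge (a + 1) b]"
    by simp
  define h where "h = p + q"
  define f where "f = level p q a"
  define n where "n = b + 2 * a - f"
  let ?m = "mass p q"
  have h: "0 < h" "odd h" "0 < 2 * p" "2 * p < h"
    using par by (auto simp: h_def parameter_def)
  \<comment> \<open>Reduction modulo \<open>2 * h\<close> keeps parity, so masses are odd and
    capacities even. A mass is therefore never 0 and never equal to a capacity, which rules out ties
    in \<open>lit\<close>.\<close>
  have mass: "[?m k = 2 * p * k + h] (mod (2 * h))" "- h \<le> ?m k" "?m k < h" "?m k \<noteq> 0" for k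
    using bal_bounds[OF h(1), of "2 * p * k + h"] bal_cong[of h "2 * p * k + h"]
      even_bal[of h "2 * p * k + h"] h(2)
    by (auto simp: mass_def simp flip: h_def)
  have cap: "[cap p q k = 4 * p * k] (mod (2 * h))" "- h \<le> cap p q k" "cap p q k < h" for k
    using bal_bounds[OF h(1), of "4 * p * k"] bal_cong[of h "4 * p * k"]
    by (auto simp: cap_def simp flip: h_def)
  have cap_mass: "cap p q k \<noteq> ?m l" for k l
    using even_bal[of h "2 * p * l + h"] even_bal[of h "4 * p * k"] h(2)
    by (auto simp: cap_def mass_def simp flip: h_def)
  have f: "h * f \<le> 2 * p * a" "2 * p * a < h * (f + 1)"
    using div_interval[OF h(1)] unfolding f_def level_def h_def by blast+
  define f' where "f' = level p q (a + 1)"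
  have f': "h * f' \<le> 2 * p * (a + 1)" "2 * p * (a + 1) < h * (f' + 1)"
    using div_interval[OF h(1)] unfolding f'_def level_def h_def by blast+
  have V: "0 \<le> a + 1" "a < p + q" "a + 1 < p + q"
    using a by auto
  have L: "good p q (VEdge a b) = (lit (cap p q a) (?m (b + f + 1)) \<noteq> lit (cap p q a) (?m n))"
    using good_V[OF par a(1) V(2)] by (simp only: f_def n_def)
  show "((good p q (VEdge a b) = good p q (VEdge (a + 1) b)) =
      (good p q (HEdge a b) = good p q (HEdge a (b + 1)))) \<and>
      \<not> (good p q (VEdge a b) \<and> good p q (VEdge (a + 1) b) \<and> good p q (HEdge a b) \<and>
        good p q (HEdge a (b + 1)))"
  proof (cases "f' = f")
    case True
    have R: "good p q (VEdge (a + 1) b) =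
        (lit (cap p q (a + 1)) (?m (b + f + 1)) \<noteq> lit (cap p q (a + 1)) (?m (n + 2)))"
      using good_V[OF par V(1,3), of b] True unfolding f'_def
      by (simp add: n_def f_def algebra_simps)
    have B: "good p q (HEdge a b) = (lit (cap p q b) (?m n) \<noteq> lit (cap p q b) (?m (n + 1)))"
      using good_H[OF par a, of b] True unfolding f'_def lower_line_def upper_line_def
      by (simp add: n_def f_def)
    have T: "good p q (HEdge a (b + 1)) =
        (lit (cap p q (b + 1)) (?m (n + 1)) \<noteq> lit (cap p q (b + 1)) (?m (n + 2)))"
      using good_H[OF par a, of "b + 1"] True unfolding f'_def lower_line_def upper_line_def
      by (simp add: n_def f_def algebra_simps)
    \<comment> \<open>\<open>A\<close> and \<open>B'\<close> represent the capacities at the centre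
      coordinates \<open>a + 1/2\<close> and \<open>b + 1/2\<close>. Subtracting
      \<open>2 * h * f\<close> puts \<open>A\<close> into the range that expresses
      \<open>f' = f\<close>.\<close>
    define A where "A = 2 * (2 * p * a - h * f) + 2 * p"
    define B' where "B' = bal h (4 * p * b + 2 * p)"
    have B': "[B' = 4 * p * b + 2 * p] (mod (2 * h))" "- h \<le> B'" "B' < h"
      using bal_bounds[OF h(1)] bal_cong by (auto simp: B'_def)
    show ?thesis
    proof (rule even_square_core[where h = h and P = "2 * p" and A = A and B = B' and
          ?g1.0 = "?m n" and ?g2.0 = "?m (n + 1)" and ?g3.0 = "?m (n + 2)" and ?g4.0 = "?m (b + f + 1)"
          and fL = "cap p q a" and fR = "cap p q (a + 1)" and fB = "cap p q b" and fT = "cap p q (b + 1)"])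
      show "2 * p \<le> A" "A < 2 * h - 2 * p"
        using f f' True by (simp_all add: A_def algebra_simps)
      show "[?m n = ?m (n + 1) - 2 * p] (mod (2 * h))"
        by (rule cong_via[OF mass(1) cong_diff[OF mass(1) cong_refl], where k = 0])
          (simp add: algebra_simps)
      show "[?m (n + 2) = ?m (n + 1) + 2 * p] (mod (2 * h))"
        by (rule cong_via[OF mass(1) cong_add[OF mass(1) cong_refl], where k = 0])
          (simp add: algebra_simps)
      \<comment> \<open>The level cancels in the sum of the two intercepts, which is
        \<open>2 * a + 2 * b + 2\<close>; hence the two masses add up to the two centre capacities
        modulo \<open>2 * h\<close>.\<close>
      show "[?m (b + f + 1) = A + B' - ?m (n + 1)] (mod (2 * h))"
        by (rule cong_via[OF mass(1) cong_diff[OF cong_add[OF cong_refl B'(1)] mass(1)],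
              where k = "- f - 1"])
          (simp add: A_def n_def algebra_simps)
      show "[cap p q a = A - 2 * p] (mod (2 * h))"
        by (rule cong_via[OF cap(1) cong_refl, where k = "- f"]) (simp add: A_def algebra_simps)
      show "[cap p q (a + 1) = A + 2 * p] (mod (2 * h))"
        by (rule cong_via[OF cap(1) cong_refl, where k = "- f"]) (simp add: A_def algebra_simps)
      show "[cap p q b = B' - 2 * p] (mod (2 * h))"
        by (rule cong_via[OF cap(1) cong_diff[OF B'(1) cong_refl], where k = 0])
          (simp add: algebra_simps)
      show "[cap p q (b + 1) = B' + 2 * p] (mod (2 * h))"
        by (rule cong_via[OF cap(1) cong_add[OF B'(1) cong_refl], where k = 0])
          (simp add: algebra_simps)
    qed (fact h B' mass cap cap_mass L R B T)+
  next
    case False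
    then have ff: "f' = f + 1"
      using level_Suc[OF par, of a] unfolding f_def f'_def by auto
    have R: "good p q (VEdge (a + 1) b) =
        (lit (cap p q (a + 1)) (?m (b + f + 2)) \<noteq> lit (cap p q (a + 1)) (?m (n + 1)))"
      using good_V[OF par V(1,3), of b] ff unfolding f'_def
      by (simp add: n_def f_def algebra_simps)
    have B: "good p q (HEdge a b) = (lit (cap p q b) (?m n) \<noteq> lit (cap p q b) (?m (b + f + 1)))"
      using good_H[OF par a, of b] ff unfolding f'_def lower_line_def upper_line_def
      by (simp add: n_def f_def)
    have T: "good p q (HEdge a (b + 1)) =
        (lit (cap p q (b + 1)) (?m (n + 1)) \<noteq> lit (cap p q (b + 1)) (?m (b + f + 2)))"
      using good_H[OF par a, of "b + 1"] ff unfolding f'_def lower_line_def upper_line_def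
      by (simp add: n_def f_def algebra_simps)
    define A where "A = 2 * (2 * p * a - h * f)"
    \<comment> \<open>This makes the lower bound on \<open>A\<close> strict: equality would send P
      lines through the lattice points of the column \<open>a + 1\<close>.\<close>
    have "\<not> h dvd 2 * p * (a + 1)"
      using parameter_dvd[OF par, of "a + 1"] a zdvd_not_zless[of "a + 1" "p + q"]
      unfolding h_def by auto
    then have "h * f' \<noteq> 2 * p * (a + 1)"
      by (metis dvd_triv_left)
    then have f'_less: "h * f' < 2 * p * (a + 1)"
      using f'(1) by linarith
    show ?thesis
    proof (rule odd_square_core[where h = h and P = "2 * p" and A = A and
          ?g1.0 = "?m n" and ?g2.0 = "?m (n + 1)" and ?g3.0 = "?m (b + f + 1)" and ?g4.0 = "?m (b + f + 2)"
          and fL = "cap p q a" and fR = "cap p q (a + 1)" and fB = "cap p q b" and fT = "cap p q (b + 1)"])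
      show "2 * (h - 2 * p) < A" "A < 2 * h"
        using f f'_less ff by (simp_all add: A_def algebra_simps)
      show "[?m (n + 1) = ?m n + 2 * p] (mod (2 * h))"
        by (rule cong_via[OF mass(1) cong_add[OF mass(1) cong_refl], where k = 0])
          (simp add: algebra_simps)
      show "[?m (b + f + 1) = A + cap p q b + 2 * p - ?m n] (mod (2 * h))"
        by (rule cong_via[OF mass(1) cong_diff[OF cong_add[OF cong_add[OF cong_refl cap(1)] cong_refl]
              mass(1)], where k = "- f - 1"])
          (simp add: A_def n_def algebra_simps)
      show "[?m (b + f + 2) = ?m (b + f + 1) + 2 * p] (mod (2 * h))"
        by (rule cong_via[OF mass(1) cong_add[OF mass(1) cong_refl], where k = 0])
          (simp add: algebra_simps)
      show "[cap p q a = A] (mod (2 * h))"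
        by (rule cong_via[OF cap(1) cong_refl, where k = "- f"]) (simp add: A_def algebra_simps)
      show "[cap p q (a + 1) = A + 2 * (2 * p)] (mod (2 * h))"
        by (rule cong_via[OF cap(1) cong_refl, where k = "- f"]) (simp add: A_def algebra_simps)
      show "[cap p q (b + 1) = cap p q b + 2 * (2 * p)] (mod (2 * h))"
        by (rule cong_via[OF cap(1) cong_add[OF cap(1) cong_refl], where k = 0])
          (simp add: algebra_simps)
    qed (fact h mass cap cap_mass L R B T)+
  qed
qed

subsection \<open>Comparison with the predecessor\<close>

lemma bal_unique:
  assumes "[x = t] (mod (2 * h))" "- h \<le> x" "x < h"
  shows "bal h t = x"
proof -
  have "(t + h) mod (2 * h) = (x + h) mod (2 * h)"
    using cong_add[OF assms(1) cong_refl[of h]] by (simp add: cong_def)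
  also have "\<dots> = x + h"
    using assms(2,3) by simp
  finally show ?thesis
    by (simp add: bal_def)
qed

lemma bal_minus:
  assumes "h > 0"
  shows "bal h (- t) = (if bal h t = - h then - h else - bal h t)"
proof (rule bal_unique)
  have t: "[- bal h t = - t] (mod (2 * h))"
    using bal_cong[of h t] by (rule cong_minus_minus_iff[THEN iffD2])
  have "[- h = h] (mod (2 * h))"
    by (simp add: cong_iff_dvd_diff)
  then show "[(if bal h t = - h then - h else - bal h t) = - t] (mod (2 * h))"
    using t cong_trans by (cases "bal h t = - h") auto
  show "- h \<le> (if bal h t = - h then - h else - bal h t)"
    "(if bal h t = - h then - h else - bal h t) < h"
    using bal_bounds[OF assms, of t] assms by auto
qed

text \<open>Negation commutes with \<open>bal\<close> except at \<open>- h\<close>. An even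
  \<open>x\<close> never has this residue since \<open>h\<close> is odd, and if \<open>y\<close> has
  it, its absolute value is too large for lightness on either side.\<close>

lemma lit_bal_sign:
  assumes "h > 0" "odd h" "d = 1 \<or> d = - 1" "even x"
  shows "lit (bal h (d * x)) (bal h (d * y)) = lit (bal h x) (bal h y)"
  using assms(3)
proof
  assume d: "d = - 1"
  define X where "X = bal h x"
  define Y where "Y = bal h y"
  have X: "X \<noteq> - h" "- h \<le> X" "X < h"
    using bal_bounds[OF assms(1), of x] even_bal[of h x] assms(2,4) unfolding X_def by auto
  have Y: "- h \<le> Y" "Y < h"
    using bal_bounds[OF assms(1), of y] unfolding Y_def by auto
  have "bal h (d * x) = - X" "bal h (d * y) = (if Y = - h then - h else - Y)"
    using X(1) bal_minus[OF assms(1), of x] bal_minus[OF assms(1), of y] unfolding d X_def Y_def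
    by simp_all
  then show ?thesis
    unfolding X_def[symmetric] Y_def[symmetric] using X Y assms(1) by (auto simp: lit_def)
qed simp

lemma dvd_gt_imp_ge_double:
  fixes m x :: int
  assumes "m dvd x" "m < x" "0 < m"
  shows "2 * m \<le> x"
proof -
  have "m dvd x - m"
    using assms(1) by simp
  then have "m \<le> x - m"
    using assms(2) by (intro zdvd_imp_le) auto
  then show ?thesis
    by simp
qed

text \<open>Here \<open>t\<close> is the tune of \<open>p'/q'\<close> and \<open>h\<close> the height of the box. All intercepts that occur in
  the box are smaller than \<open>M\<close>, the first dangerous one.\<close>

locale copying =
  fixes p q p' q' d t w h M om om' :: int
  assumes par: "parameter p q" and par': "parameter p' q'"
    and om: "om = p + q" and om': "om' = p' + q'"
    and d: "d = 1 \<or> d = - 1" and det: "p * om' - p' * om = d"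
    and w: "0 < w" "w \<le> t" "w \<le> om' - 2 * t"
    and kinds: "om = om' + 2 * t \<and> [2 * p' * t = - d] (mod om') \<and> M = om' + t \<and> h = om' - w \<or>
      om = 3 * om' - 2 * t \<and> [2 * p' * t = d] (mod om') \<and> M = 2 * om' - t \<and> h = om'"
begin

section \<open>Residues of the two parameters and their signs\<close>

lemma om_facts: "0 < om" "odd om" "0 < om'" "odd om'"
  using par par' om om' by (auto simp: parameter_def)

text \<open>All intercepts in the box are at most \<open>h + 2 * w - 1\<close>. That this stays
  below \<open>M\<close> uses \<open>w \<le> t\<close> in the weak case and both upper bounds on
  \<open>w\<close> in the strong case.\<close>

lemma bounds: "3 * w \<le> om'" "2 * w < M" "h + 2 * w - 1 < M" "M \<le> om" "h \<le> om'" "w \<le> h" "h < M"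
    "2 * M = om + om'" "om' < om"
  using w kinds by auto

lemma dd: "d * d = 1"
  using d by auto

text \<open>The factor \<open>d\<close> normalizes the determinant: with it the perturbation between
  the residues of intercept \<open>n\<close> is \<open>+ 2 * n\<close> for either sign, while
  \<open>lit\<close> is unaffected by \<open>lit_bal_sign\<close>.\<close>

definition F where "F z = bal om (d * (4 * p * z))"
definition F' where "F' z = bal om' (d * (4 * p' * z))"
definition G where "G n = bal om (d * (2 * p * n + om))"
definition G' where "G' n = bal om' (d * (2 * p' * n + om'))"

lemma lit_F_G: "lit (cap p q z) (mass p q n) = lit (F z) (G n)"
  unfolding F_def G_def cap_def mass_def om[symmetric]
  using lit_bal_sign[OF om_facts(1,2) d, of "4 * p * z"] by simp

lemma lit_F_G': "lit (cap p' q' z) (mass p' q' n) = lit (F' z) (G' n)"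
  unfolding F'_def G'_def cap_def mass_def om'[symmetric]
  using lit_bal_sign[OF om_facts(3,4) d, of "4 * p' * z"] by simp

text \<open>Up to sign \<open>t\<close> inverts \<open>2 * p'\<close> modulo \<open>om'\<close>, so
  the residue \<open>s\<close> can be solved for the intercept \<open>n\<close>. The sign differs
  between the two cases.\<close>

lemma tune_multiple:
  assumes "[s = d * (2 * p' * (- n) + om')] (mod (2 * om'))"
  shows "om = om' + 2 * t \<Longrightarrow> om' dvd n - s * t"
    and "om = 3 * om' - 2 * t \<Longrightarrow> om' dvd n + s * t"
proof -
  have "[s = d * (2 * p' * (- n) + om')] (mod om')"
    using assms by (rule cong_dvd_modulus) simp
  then have "om' dvd s - d * (2 * p' * (- n) + om')"
    by (simp only: cong_iff_dvd_diff)
  then have "om' dvd (s - d * (2 * p' * (- n) + om')) + d * om'"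
    by (rule dvd_add) simp
  moreover have "(s - d * (2 * p' * (- n) + om')) + d * om' = s + d * (2 * p' * n)"
    by (simp add: algebra_simps)
  ultimately have "om' dvd s + d * (2 * p' * n)"
    by (simp only:)
  then have "om' dvd d * (s + d * (2 * p' * n))"
    by (rule dvd_mult)
  moreover have "d * (s + d * (2 * p' * n)) = s * d + 2 * p' * n"
    using d by auto
  ultimately have n: "om' dvd s * d + 2 * p' * n"
    by simp
  show "om' dvd n - s * t" if weak: "om = om' + 2 * t"
  proof -
    \<comment> \<open>Both alternatives of \<open>kinds\<close> at once would give
      \<open>om' = 2 * t\<close>, contrary to oddness.\<close>
    have "[2 * p' * t = - d] (mod om')"
      using kinds weak om_facts(4) by auto
    then have "om' dvd s * (2 * p' * t - (- d))"
      by (intro dvd_mult) (simp only: cong_iff_dvd_diff)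
    with n have "om' dvd (s * d + 2 * p' * n) - s * (2 * p' * t - (- d))"
      by (rule dvd_diff)
    moreover have "(s * d + 2 * p' * n) - s * (2 * p' * t - (- d)) = 2 * p' * (n - s * t)"
      by (simp add: algebra_simps)
    ultimately show ?thesis
      using parameter_dvd[OF par'] om' by metis
  qed
  show "om' dvd n + s * t" if strong: "om = 3 * om' - 2 * t"
  proof -
    have "[2 * p' * t = d] (mod om')"
      using kinds strong om_facts(4) by auto
    then have "om' dvd s * (2 * p' * t - d)"
      by (intro dvd_mult) (simp only: cong_iff_dvd_diff)
    with n have "om' dvd (s * d + 2 * p' * n) + s * (2 * p' * t - d)"
      by (rule dvd_add)
    moreover have "(s * d + 2 * p' * n) + s * (2 * p' * t - d) = 2 * p' * (n + s * t)"
      by (simp add: algebra_simps)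
    ultimately show ?thesis
      using parameter_dvd[OF par'] om' by metis
  qed
qed

text \<open>For \<open>s \<ge> 2\<close> the bound \<open>n < M \<le> om\<close> suffices. For
  \<open>s = 1\<close>, \<open>tune_multiple\<close> places \<open>n\<close> in the class of
  \<open>t\<close> or \<open>- t\<close> modulo \<open>om'\<close>, and the first member of that
  class beyond \<open>om / 2\<close> is \<open>M\<close> itself.\<close>

lemma residue_dominates:
  assumes "[s = d * (2 * p' * (- n) + om')] (mod (2 * om'))" "0 < s" "odd s" "n < M"
  shows "2 * n < s * om"
proof (rule ccontr)
  assume "\<not> 2 * n < s * om"
  then have n: "s * om \<le> 2 * n"
    by simp
  have "s = 1"
  proof (rule ccontr)
    assume "s \<noteq> 1"
    then have "2 * om \<le> s * om"
      using assms(2) om_facts(1) by (intro mult_right_mono) auto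
    then show False
      using n assms(4) bounds(4) by linarith
  qed
  from kinds show False
  proof
    assume weak: "om = om' + 2 * t \<and> [2 * p' * t = - d] (mod om') \<and> M = om' + t \<and> h = om' - w"
    then have "om' dvd n - t"
      using tune_multiple(1)[OF assms(1)] \<open>s = 1\<close> by simp
    moreover have "n - t > 0"
      using n \<open>s = 1\<close> weak om_facts(3) by simp
    ultimately have "om' \<le> n - t"
      by (rule zdvd_imp_le)
    then show False
      using assms(4) weak by simp
  next
    assume strong: "om = 3 * om' - 2 * t \<and> [2 * p' * t = d] (mod om') \<and> M = 2 * om' - t \<and> h = om'"
    then have "om' dvd n + t"
      using tune_multiple(2)[OF assms(1)] \<open>s = 1\<close> by simp
    moreover have "om' < n + t"
      using n \<open>s = 1\<close> strong om_facts(3) by simp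
    ultimately have "2 * om' \<le> n + t"
      using om_facts(3) by (rule dvd_gt_imp_ge_double)
    then show False
      using assms(4) strong by simp
  qed
qed

lemma odd_d_mult_om': "[d * om' = om'] (mod (2 * om'))"
  using d by (auto simp: cong_iff_dvd_diff)

text \<open>The term \<open>2 * m\<close> could change the sign only against a small
  \<open>s\<close>, which \<open>residue_dominates\<close> forbids. Negating \<open>s\<close> and
  \<open>m\<close> together reduces negative \<open>s\<close> to positive \<open>s\<close>.\<close>

lemma sign_transfer:
  assumes "[s = d * (2 * p' * m + om')] (mod (2 * om'))" "odd s" "- M < m" "m < M"
  shows "0 < s * om + 2 * m \<longleftrightarrow> 0 < s" and "s * om + 2 * m < 0 \<longleftrightarrow> s < 0"
proof -
  have "odd (s * om + 2 * m)"
    using assms(2) om_facts(2) by simp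
  then have "s \<noteq> 0" "s * om + 2 * m \<noteq> 0"
    using assms(2) by (metis even_zero)+
  moreover have "s * om + 2 * m > 0" if "s > 0"
    using residue_dominates[of s "- m"] assms that by simp
  moreover have "s * om + 2 * m < 0" if "s < 0"
  proof -
    have "[- s = - (d * (2 * p' * m + om'))] (mod (2 * om'))"
      using assms(1) by (rule cong_minus_minus_iff[THEN iffD2])
    then have "[- s = d * (2 * p' * (- m) + om')] (mod (2 * om'))"
      \<comment> \<open>Negation also flips the term \<open>d * om'\<close>; the quotient
        \<open>d\<close> repairs this modulo \<open>2 * om'\<close>.\<close>
      by (rule cong_via[OF _ cong_refl, where k = d]) (simp add: algebra_simps)
    then show ?thesis
      using residue_dominates[of "- s" m] assms that by simp
  qed
  ultimately show "0 < s * om + 2 * m \<longleftrightarrow> 0 < s" "s * om + 2 * m < 0 \<longleftrightarrow> s < 0"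
    by linarith+
qed

lemma odd_G: "odd (G n)" "odd (G' n)" and even_F: "even (F z)" "even (F' z)"
  using d om_facts by (auto simp: G_def G'_def F_def F'_def even_bal)

lemma G'_cong: "[G' n = d * (2 * p' * n + om')] (mod (2 * om'))"
  unfolding G'_def by (rule bal_cong)

lemma F'_cong: "[F' z = d * (4 * p' * z)] (mod (2 * om'))"
  unfolding F'_def by (rule bal_cong)

lemma F_G_bounds:
  "- om \<le> F z" "F z < om" "- om' \<le> F' z" "F' z < om'"
  "- om \<le> G n" "G n < om" "- om' \<le> G' n" "G' n \<le> om' - 2"
proof -
  show "- om \<le> F z" "F z < om" "- om' \<le> F' z" "F' z < om'" "- om \<le> G n" "G n < om" "- om' \<le> G' n"
    using bal_bounds om_facts unfolding F_def F'_def G_def G'_def by blast+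
  have "G' n < om'"
    using bal_bounds om_facts unfolding G'_def by blast
  \<comment> \<open>The unit gained from parity leaves room for the perturbation
    \<open>2 * n < 2 * om\<close> in \<open>G_relation\<close>.\<close>
  moreover have "G' n \<noteq> om' - 1"
    using odd_G(2)[of n] om_facts(4) by auto
  ultimately show "G' n \<le> om' - 2"
    by simp
qed

text \<open>Over the common modulus \<open>2 * om * om'\<close> both sides are congruent and lie in
  the same fundamental window. The integer \<open>j\<close> counts the windows by which the
  unreduced values are shifted.\<close>

lemma scaled_unique:
  assumes "[x = u] (mod (2 * om))" "[y = v] (mod (2 * om'))" "om' * u = om * v + c + 2 * om * om' * j"
    and "- (om * om') \<le> om * y + c" "om * y + c < om * om'" "- om \<le> x" "x < om"
  shows "om' * x = om * y + c"
proof -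
  have dvd: "2 * om dvd x - u" "2 * om' dvd v - y"
    using assms(1,2) cong_iff_dvd_diff cong_sym by metis+
  have "2 * (om * om') dvd om' * (x - u)"
    using mult_dvd_mono[OF dvd_refl[of om'] dvd(1)] by (simp add: ac_simps)
  moreover have "2 * (om * om') dvd om * (v - y)"
    using mult_dvd_mono[OF dvd_refl[of om] dvd(2)] by (simp add: ac_simps)
  moreover have "2 * (om * om') dvd 2 * (om * om') * j"
    by simp
  ultimately have "2 * (om * om') dvd om' * (x - u) + om * (v - y) + 2 * (om * om') * j"
    by (intro dvd_add)
  moreover have "om' * (x - u) + om * (v - y) + 2 * (om * om') * j = om' * x - (om * y + c)"
    using assms(3) by (simp add: algebra_simps)
  ultimately have "[om' * x = om * y + c] (mod (2 * (om * om')))"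
    by (simp only: cong_iff_dvd_diff)
  moreover have "- (om * om') \<le> om' * x" "om' * x < om * om'"
    using mult_left_mono[OF assms(6), of om'] mult_strict_left_mono[OF assms(7), of om'] om_facts
    by (simp_all add: ac_simps)
  ultimately have "bal (om * om') (om * y + c) = om' * x"
    by (intro bal_unique)
  moreover have "bal (om * om') (om * y + c) = om * y + c"
    using assms(4,5) by (intro bal_unique) simp_all
  ultimately show ?thesis
    by simp
qed

lemma det_scaled: "om' * (d * (2 * p * n)) = om * (d * (2 * p' * n)) + 2 * n"
proof -
  have "om' * (d * (2 * p * n)) - om * (d * (2 * p' * n)) = 2 * n * d * (p * om' - p' * om)"
    by (simp add: algebra_simps)
  also have "\<dots> = 2 * n * (d * d)"
    unfolding det by (simp add: ac_simps)
  finally show ?thesis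
    by (simp add: dd)
qed

lemma G_relation:
  assumes "0 \<le> n" "n < M"
  shows "om' * G n = om * G' n + 2 * n"
proof (rule scaled_unique[where u = "d * (2 * p * n + om)" and v = "d * (2 * p' * n + om')" and j = 0])
  show "[G n = d * (2 * p * n + om)] (mod (2 * om))"
    unfolding G_def by (rule bal_cong)
  show "om' * (d * (2 * p * n + om)) = om * (d * (2 * p' * n + om')) + 2 * n + 2 * om * om' * 0"
    using det_scaled[of n] by (simp add: algebra_simps)
  show "- (om * om') \<le> om * G' n + 2 * n"
    using mult_left_mono[OF F_G_bounds(7), of om n] om_facts assms(1) by simp
  have "om * G' n \<le> om * (om' - 2)"
    using F_G_bounds(8) om_facts by (intro mult_left_mono) auto
  then show "om * G' n + 2 * n < om * om'"
    using assms(2) bounds(4) by (simp add: algebra_simps)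
qed (rule G'_cong F_G_bounds)+

text \<open>The distance of a capacity from its upper wrap-around is again a residue of the kind
  treated in \<open>tune_multiple\<close>, with \<open>2 * z\<close> as intercept.\<close>

lemma complement_cong: "[om' - F' z = d * (2 * p' * (- (2 * z)) + om')] (mod (2 * om'))"
proof -
  have "[om' - F' z = om' - d * (4 * p' * z)] (mod (2 * om'))"
    by (intro cong_diff cong_refl F'_cong)
  moreover have "[om' - d * (4 * p' * z) = d * om' - d * (4 * p' * z)] (mod (2 * om'))"
    by (intro cong_diff cong_refl cong_sym[OF odd_d_mult_om'])
  moreover have "d * om' - d * (4 * p' * z) = d * (2 * p' * (- (2 * z)) + om')"
    by (simp add: algebra_simps)
  ultimately show ?thesis
    using cong_trans by metis
qed

text \<open>Since \<open>2 * z\<close> may exceed \<open>M\<close>, \<open>residue_dominates\<close>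
  covers only part of the range. Above \<open>M\<close> the distance \<open>s\<close> could only be
  1 or 3, and divisibility by \<open>om'\<close> would then push \<open>z\<close> out of the box. At
  \<open>2 * z = M\<close> the estimate really fails.\<close>

lemma cap_no_overflow:
  assumes "0 \<le> z" "z \<le> h" "2 * z \<noteq> M"
  shows "4 * z < (om' - F' z) * om"
proof -
  define s where "s = om' - F' z"
  have s: "0 < s" "odd s"
    using F_G_bounds(4)[of z] even_F(2)[of z] om_facts(4) by (auto simp: s_def)
  note cong = complement_cong[of z, folded s_def]
  show ?thesis
  proof (cases "2 * z < M")
    case True
    then show ?thesis
      using residue_dominates[OF cong s] by (simp add: s_def)
  next
    case False
    then have z: "2 * z > M"
      using assms(3) by simp
    show ?thesis
      unfolding s_def[symmetric]
    proof (rule ccontr)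
      assume "\<not> 4 * z < s * om"
      then have le: "s * om \<le> 4 * z"
        by simp
      have "s < 4"
      proof (rule ccontr)
        assume "\<not> s < 4"
        then have "4 * om \<le> s * om"
          using om_facts(1) by (intro mult_right_mono) auto
        then show False
          using le assms(2) bounds(5,9) by linarith
      qed
      then have "s = 1 \<or> s = 2 \<or> s = 3"
        using s(1) by linarith
      then have s13: "s = 1 \<or> s = 3"
        using s(2) by auto
      from kinds show False
      proof
        assume weak: "om = om' + 2 * t \<and> [2 * p' * t = - d] (mod om') \<and> M = om' + t \<and> h = om' - w"
        then have "om' dvd 2 * z - s * t"
          using tune_multiple(1)[OF cong] by simp
        moreover have "om' < 2 * z - s * t"
          using s13 le z weak om_facts(3) by auto
        \<comment> \<open>The next multiple of \<open>om'\<close> needs \<open>z \<ge> om'\<close>,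
          above the truncated height \<open>om' - w\<close> of the weak case.\<close>
        ultimately have "2 * om' \<le> 2 * z - s * t"
          using om_facts(3) by (rule dvd_gt_imp_ge_double)
        moreover have "0 \<le> s * t"
          using s(1) w by simp
        ultimately show False
          using weak assms(2) w(1) by simp
      next
        assume strong: "om = 3 * om' - 2 * t \<and> [2 * p' * t = d] (mod om') \<and> M = 2 * om' - t \<and> h = om'"
        have "s = 1"
          using s13 le assms(2) strong w om_facts(3) by auto
        then have "om' dvd 2 * z + t"
          using tune_multiple(2)[OF cong] strong by simp
        then have "om' dvd 2 * z + t - om'"
          by (intro dvd_diff) simp_all
        moreover have "om' < 2 * z + t - om'"
          using z strong by simp
        ultimately have "2 * om' \<le> 2 * z + t - om'"
          using om_facts(3) by (rule dvd_gt_imp_ge_double)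
        then show False
          using strong assms(2) w by simp
      qed
    qed
  qed
qed

lemma F_relation:
  assumes "0 \<le> z" "z \<le> h" "2 * z \<noteq> M"
  shows "om' * F z = om * F' z + 4 * z"
proof (rule scaled_unique[where u = "d * (4 * p * z)" and v = "d * (4 * p' * z)" and j = 0])
  show "[F z = d * (4 * p * z)] (mod (2 * om))"
    unfolding F_def by (rule bal_cong)
  show "om' * (d * (4 * p * z)) = om * (d * (4 * p' * z)) + 4 * z + 2 * om * om' * 0"
    using det_scaled[of "2 * z"] by simp
  show "- (om * om') \<le> om * F' z + 4 * z"
    using mult_left_mono[OF F_G_bounds(3), of om z] om_facts assms(1) by simp
  show "om * F' z + 4 * z < om * om'"
    using cap_no_overflow[OF assms] by (simp add: algebra_simps)
qed (rule F'_cong F_G_bounds)+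

text \<open>The exceptional level, where the capacity wraps around.\<close>

lemma F_flip:
  assumes "2 * z = M"
  shows "F' z = om' - 1" "F z = - (om - 1)"
proof -
  have F'_cong1: "[om' - 1 = d * (4 * p' * z)] (mod (2 * om'))"
  proof -
    have z: "d * (4 * p' * z) = d * (2 * p' * M)"
      using assms by simp
    \<comment> \<open>The sign \<open>e\<close> unites the cases: it is 1 in the weak and -1 in the
      strong case, and \<open>M\<close> is congruent to \<open>e * t\<close> modulo
      \<open>om'\<close>.\<close>
    obtain e i where e: "e = 1 \<or> e = - 1" "[2 * p' * t = - (e * d)] (mod om')"
      and i: "M = i * om' + e * t"
    proof -
      from kinds show thesis
      proof
        assume "om = om' + 2 * t \<and> [2 * p' * t = - d] (mod om') \<and> M = om' + t \<and> h = om' - w"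
        then show thesis
          by (intro that[of 1 1]) auto
      next
        assume "om = 3 * om' - 2 * t \<and> [2 * p' * t = d] (mod om') \<and> M = 2 * om' - t \<and> h = om'"
        then show thesis
          by (intro that[of "- 1" 2]) auto
      qed
    qed
    from e(2) have "om' dvd 2 * p' * t + e * d"
      by (simp add: cong_iff_dvd_diff)
    then obtain j where j: "2 * p' * t + e * d = om' * j" ..
    \<comment> \<open>The tune congruence holds only modulo \<open>om'\<close>; the parity of the
      cofactor \<open>j\<close> lifts it to \<open>2 * om'\<close>.\<close>
    have "odd (e * d)"
      using e(1) d by auto
    then have "odd (om' * j)"
      unfolding j[symmetric] by simp
    then have "odd j"
      by simp
    have "d * e * (2 * p' * t + e * d) = d * e * (om' * j)"
      unfolding j ..
    moreover have "d * e * (e * d) = 1"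
      using e(1) d by auto
    ultimately have "d * (2 * p' * (e * t)) = om' * (d * e * j) - 1"
      by (simp add: algebra_simps)
    then have M: "d * (2 * p' * M) = (om' - 1) + 2 * om' * (d * p' * i) + om' * (d * e * j - 1)"
      unfolding i by (simp add: algebra_simps)
    have "even (d * e * j - 1)"
      using \<open>odd j\<close> \<open>odd (e * d)\<close> by simp
    then obtain l where l: "d * e * j - 1 = 2 * l" ..
    have "d * (4 * p' * z) = (om' - 1) + 2 * om' * (d * p' * i + l)"
      unfolding z M l by (simp add: algebra_simps)
    then show ?thesis
      unfolding cong_iff_lin by (rule exI)
  qed
  then show F': "F' z = om' - 1"
    unfolding F'_def using om_facts by (intro bal_unique) auto
  \<comment> \<open>Adding \<open>4 * z = 2 * M\<close> to \<open>om * (om' - 1)\<close> overshoots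
    the window exactly once, hence \<open>j = 1\<close>.\<close>
  have "om' * F z = om * (om' - 1) + (2 * M - 2 * (om * om'))"
  proof (rule scaled_unique[where u = "d * (4 * p * z)" and v = "d * (4 * p' * z)" and j = 1])
    show "[F z = d * (4 * p * z)] (mod (2 * om))"
      unfolding F_def by (rule bal_cong)
    show "om' * (d * (4 * p * z)) =
        om * (d * (4 * p' * z)) + (2 * M - 2 * (om * om')) + 2 * om * om' * 1"
      using det_scaled[of "2 * z"] assms[symmetric] by simp
    show "- (om * om') \<le> om * (om' - 1) + (2 * M - 2 * (om * om'))"
      "om * (om' - 1) + (2 * M - 2 * (om * om')) < om * om'"
      using bounds(8) om_facts mult_mono[of 1 om 1 om'] by (simp_all add: algebra_simps)
  qed (rule F'_cong1 F_G_bounds)+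
  also have "\<dots> = om' * (- (om - 1))"
    unfolding bounds(8) by (simp add: algebra_simps)
  finally show "F z = - (om - 1)"
    using om_facts(3) by simp
qed

section \<open>Lightness for the two parameters\<close>

lemma mult_om'_sign: "0 < om' * x \<longleftrightarrow> 0 < x" "om' * x < 0 \<longleftrightarrow> x < 0"
  using om_facts(3) by (auto simp: zero_less_mult_iff mult_less_0_iff)

lemma G_sign:
  assumes "0 \<le> n" "n < M"
  shows "0 < G n \<longleftrightarrow> 0 < G' n" "G n < 0 \<longleftrightarrow> G' n < 0"
proof -
  have "- M < n"
    using assms by simp
  note sign = sign_transfer[OF G'_cong odd_G(2) this assms(2)]
  have "om' * G n = G' n * om + 2 * n"
    using G_relation[OF assms] by (simp add: ac_simps)
  then show "0 < G n \<longleftrightarrow> 0 < G' n" "G n < 0 \<longleftrightarrow> G' n < 0"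
    using sign mult_om'_sign[of "G n"] by (simp_all only:)
qed

text \<open>A capacity minus a mass is again a residue to which \<open>sign_transfer\<close>
  applies, with \<open>2 * z - n\<close> as the intercept.\<close>

lemma difference_sign:
  assumes "0 \<le> z" "z \<le> h" "2 * z \<noteq> M" "0 \<le> n" "n < M" "2 * z - n < M" "n - 2 * z < M"
  shows "0 < F z - G n \<longleftrightarrow> 0 < F' z - G' n" "F z - G n < 0 \<longleftrightarrow> F' z - G' n < 0"
proof -
  have "[F' z - G' n = d * (4 * p' * z) - d * (2 * p' * n + om')] (mod (2 * om'))"
    by (intro cong_diff F'_cong G'_cong)
  then have cong: "[F' z - G' n = d * (2 * p' * (2 * z - n) + om')] (mod (2 * om'))"
    by (rule cong_via[OF _ cong_refl, where k = d]) (simp add: algebra_simps)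
  have "odd (F' z - G' n)" "- M < 2 * z - n"
    using odd_G even_F assms(7) by simp_all
  note sign = sign_transfer[OF cong this assms(6)]
  have "om' * (F z - G n) = (F' z - G' n) * om + 2 * (2 * z - n)"
    using G_relation[OF assms(4,5)] F_relation[OF assms(1-3)] by (simp add: algebra_simps)
  then show "0 < F z - G n \<longleftrightarrow> 0 < F' z - G' n" "F z - G n < 0 \<longleftrightarrow> F' z - G' n < 0"
    using sign mult_om'_sign[of "F z - G n"] by (simp_all only:)
qed

lemma lit_same:
  assumes "0 \<le> z" "z \<le> h" "2 * z \<noteq> M" "0 \<le> n" "n < M" "2 * z - n < M" "n - 2 * z < M"
  shows "lit (cap p q z) (mass p q n) = lit (cap p' q' z) (mass p' q' n)"
  unfolding lit_F_G lit_F_G' unfolding lit_def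
  using G_sign[OF assms(4,5)] difference_sign[OF assms] by auto

text \<open>Here \<open>F' z\<close> is the largest and \<open>F z\<close> the smallest possible
  even residue, so lightness means \<open>0 < G' n\<close> on one side and \<open>G n < 0\<close> on
  the other, while the signs of \<open>G n\<close> and \<open>G' n\<close> agree. Positivity of
  \<open>n\<close> keeps \<open>G n\<close> away from \<open>- om\<close>.\<close>

lemma lit_flip:
  assumes "2 * z = M" "0 < n" "n < M"
  shows "lit (cap p q z) (mass p q n) \<longleftrightarrow> \<not> lit (cap p' q' z) (mass p' q' n)"
proof -
  have "G n \<noteq> - om"
  proof
    assume "G n = - om"
    then have "om' * (- om) = om * G' n + 2 * n"
      using G_relation[of n] assms by simp
    moreover have "om * (- om') \<le> om * G' n"
      using F_G_bounds(7) om_facts by (intro mult_left_mono) auto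
    ultimately show False
      using assms(2) by (simp add: algebra_simps)
  qed
  moreover have "G n \<noteq> - (om - 1)"
    using odd_G(1)[of n] om_facts(2) by auto
  ultimately have "- (om - 1) < G n"
    using F_G_bounds(5)[of n] by linarith
  moreover have "G n \<noteq> 0" "G' n \<noteq> 0"
    using odd_G[of n] by auto
  ultimately show ?thesis
    unfolding lit_F_G lit_F_G' unfolding lit_def F_flip[OF assms(1)]
    using G_sign[of n] assms F_G_bounds(8)[of n] om_facts by auto
qed

text \<open>On the exceptional level both statuses flip, so their comparison survives. The last
  assumption bounds \<open>2 * z - n\<close> by \<open>M\<close>: vertical edges satisfy its first
  alternative because \<open>2 * w < M\<close>, horizontal edges its second because their intercepts
  are at least \<open>z\<close>.\<close>

lemma lit_parity_transfer:
  assumes "0 \<le> z" "z \<le> h" "0 \<le> n1" "n1 < M" "0 \<le> n2" "n2 < M"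
    and "2 * z < M \<or> z \<le> n1 \<and> z \<le> n2"
  shows "(lit (cap p q z) (mass p q n1) \<noteq> lit (cap p q z) (mass p q n2)) \<longleftrightarrow>
    (lit (cap p' q' z) (mass p' q' n1) \<noteq> lit (cap p' q' z) (mass p' q' n2))"
proof (cases "2 * z = M")
  case True
  moreover have "0 < M"
    using bounds(8) om_facts by linarith
  ultimately have "0 < n1" "0 < n2"
    using assms by auto
  then show ?thesis
    using lit_flip[OF True] assms by auto
next
  case False
  have "2 * z - n1 < M" "2 * z - n2 < M" "n1 - 2 * z < M" "n2 - 2 * z < M"
    using assms bounds(7) by auto
  then show ?thesis
    using lit_same[OF assms(1,2) False] assms by auto
qed

text \<open>The remainders \<open>u\<close> and \<open>r\<close> behind the two levels satisfy
  \<open>om' * u = om * r + 2 * (d * a)\<close>. For \<open>0 < a\<close> the remainder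
  \<open>r\<close> is neither 0 nor \<open>om'\<close>, and the perturbation is smaller than
  \<open>om\<close>, so \<open>u\<close> stays strictly between 0 and \<open>om\<close>.\<close>

lemma level_transfer:
  assumes "0 \<le> a" "a \<le> w"
  shows "level p q a = level p' q' a"
proof (cases "a = 0")
  case True
  then show ?thesis
    by (simp add: level_def)
next
  case False
  define f where "f = level p' q' a"
  define r where "r = 2 * p' * a - om' * f"
  have r: "0 \<le> r" "r < om'"
    using div_interval[OF om_facts(3), of "2 * p' * a"]
    by (simp_all add: r_def f_def level_def algebra_simps flip: om')
  have "\<not> om' dvd a"
    using False assms w bounds(1) by (intro zdvd_not_zless) auto
  then have "\<not> om' dvd 2 * p' * a"
    using parameter_dvd[OF par'] om' by blast
  then have "r \<noteq> 0"
    unfolding r_def by auto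
  define u where "u = 2 * p * a - om * f"
  have "d * (om' * (d * (2 * p * a))) = d * (om * (d * (2 * p' * a)) + 2 * a)"
    unfolding det_scaled ..
  then have "(d * d) * (om' * (2 * p * a)) = (d * d) * (om * (2 * p' * a)) + 2 * (d * a)"
    by (simp only: algebra_simps)
  then have u: "om' * u = om * r + 2 * (d * a)"
    unfolding dd u_def r_def by (simp add: algebra_simps)
  have da: "- a \<le> d * a" "d * a \<le> a"
    using d assms(1) by auto
  have "om * 1 \<le> om * r" "om * r \<le> om * (om' - 1)"
    using r \<open>r \<noteq> 0\<close> om_facts by (intro mult_left_mono; simp)+
  moreover have "- om < 2 * (d * a)" "2 * (d * a) < om"
    using da assms(2) bounds(1,9) w(1) by linarith+
  ultimately have "0 < om * r + 2 * (d * a)" "om * r + 2 * (d * a) < om' * om"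
    unfolding right_diff_distrib mult.commute[of om'] by linarith+
  then have "0 < om' * u" "om' * u < om' * om"
    unfolding u .
  then have "0 < u" "u < om"
    using om_facts by (simp_all add: zero_less_mult_iff)
  moreover have "2 * p * a = om * f + u"
    by (simp add: u_def)
  ultimately have "2 * p * a div om = f"
    by (intro int_div_pos_eq[of _ _ _ u]) auto
  then have "level p q a = f"
    by (simp add: level_def om)
  then show ?thesis
    by (simp add: f_def)
qed

section \<open>Goodness of the edges of the box\<close>

lemma level_le: "0 \<le> a \<Longrightarrow> 0 \<le> level p' q' a" "0 \<le> a \<Longrightarrow> level p' q' a \<le> a"
  using level_bounds[OF par'] by blast+

lemma good_V_transfer:
  assumes "0 \<le> a" "a \<le> w" "0 \<le> b" "b < h"
  shows "good p q (VEdge a b) = good p' q' (VEdge a b)"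
proof -
  have a: "a < p + q" "a < p' + q'"
    using assms bounds w unfolding om[symmetric] om'[symmetric] by linarith+
  show ?thesis
    unfolding good_V[OF par assms(1) a(1)] good_V[OF par' assms(1) a(2)] level_transfer[OF assms(1,2)]
    using assms bounds w level_le[OF assms(1)] by (intro lit_parity_transfer) linarith+
qed

lemma good_H_transfer:
  assumes "0 \<le> a" "a < w" "0 \<le> b" "b \<le> h"
  shows "good p q (HEdge a b) = good p' q' (HEdge a b)"
proof -
  have a: "2 * a + 1 < p + q" "2 * a + 1 < p' + q'"
    using assms bounds w unfolding om[symmetric] om'[symmetric] by linarith+
  have lines: "lower_line p q a b = lower_line p' q' a b" "upper_line p q a b = upper_line p' q' a b"
    unfolding lower_line_def upper_line_def
    using level_transfer[of a] level_transfer[of "a + 1"] assms by simp_all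
  show ?thesis
    unfolding good_H[OF par assms(1) a(1)] good_H[OF par' assms(1) a(2)] lines
    using assms bounds w level_le[OF assms(1)]
    by (intro lit_parity_transfer) (auto simp: lower_line_def upper_line_def)
qed

end

subsection \<open>Transfer of goodness to plaid sets\<close>

text \<open>The segment is axis-parallel of length 1/2 and its other coordinate is a half-integer,
  so a segment from a square outside can reach the box only with its endpoint on the
  boundary.\<close>

lemma segment_meets_box:
  fixes w h :: int
  assumes z: "z \<in> closed_segment (square_center a b) (edge_center e)" "e \<in> square_edges a b"
    and wh: "0 < w" "0 < h"
    and box: "z \<in> {0..of_int w} \<times> {0..of_int h}"
  shows "0 \<le> a \<and> a < w \<and> 0 \<le> b \<and> b < h \<or>
    z = edge_center e \<and> (\<exists>a b. 0 \<le> a \<and> a < w \<and> 0 \<le> b \<and> b < h \<and> e \<in> square_edges a b)"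
proof -
  obtain u where u: "0 \<le> u" "u \<le> 1" "z = (1 - u) *\<^sub>R square_center a b + u *\<^sub>R edge_center e"
    using z(1) by (auto simp: in_segment)
  obtain x y where xy: "z = (x, y)" "0 \<le> x" "x \<le> of_int w" "0 \<le> y" "y \<le> of_int h"
    using box by (cases z) auto
  have square: "e \<in> square_edges a' b'" if "e = VEdge a' b' \<or> e = VEdge (a' + 1) b' \<or>
      e = HEdge a' b' \<or> e = HEdge a' (b' + 1)" for a' b'
    using that by (auto simp: square_edges_def)
  consider "e = VEdge a b" | "e = VEdge (a + 1) b" | "e = HEdge a b" | "e = HEdge a (b + 1)"
    using z(2) by (auto simp: square_edges_def)
  then show ?thesis
  proof cases
    case 1
    then have eq: "x = of_int a + 1 / 2 - u / 2" "y = of_int b + 1 / 2"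
      using u(3) xy(1) by (auto simp: square_center_def field_simps)
    \<comment> \<open>The constant coordinate \<open>b + 1/2\<close> fixes the row; only the column
      can be off by one.\<close>
    then have b: "0 \<le> b" "b < h" and a: "0 \<le> a" "a \<le> w"
      using xy u(1,2) by linarith+
    show ?thesis
    proof (cases "a = w")
      case True
      then have "u = 1"
        using eq(1) xy(3) u(2) by simp
      then show ?thesis
        using a b wh True u(3) 1 square[of "w - 1" "b"]
        by (intro disjI2 conjI exI[of _ "w - 1"] exI[of _ "b"]) simp_all
    qed (use a b in simp)
  next
    case 2
    then have eq: "x = of_int a + 1 / 2 + u / 2" "y = of_int b + 1 / 2"
      using u(3) xy(1) by (auto simp: square_center_def field_simps)
    then have b: "0 \<le> b" "b < h" and a: "- 1 \<le> a" "a < w"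
      using xy u(1,2) by linarith+
    show ?thesis
    proof (cases "a = - 1")
      case True
      then have "u = 1"
        using eq(1) xy(2) u(2) by simp
      then show ?thesis
        using a b wh True u(3) 2 square[of "0" "b"]
        by (intro disjI2 conjI exI[of _ "0"] exI[of _ "b"]) simp_all
    qed (use a b in simp)
  next
    case 3
    then have eq: "x = of_int a + 1 / 2" "y = of_int b + 1 / 2 - u / 2"
      using u(3) xy(1) by (auto simp: square_center_def field_simps)
    then have b: "0 \<le> b" "b \<le> h" and a: "0 \<le> a" "a < w"
      using xy u(1,2) by linarith+
    show ?thesis
    proof (cases "b = h")
      case True
      then have "u = 1"
        using eq(2) xy(5) u(2) by simp
      then show ?thesis
        using a b wh True u(3) 3 square[of "a" "h - 1"]
        by (intro disjI2 conjI exI[of _ "a"] exI[of _ "h - 1"]) simp_all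
    qed (use a b in simp)
  next
    case 4
    then have eq: "x = of_int a + 1 / 2" "y = of_int b + 1 / 2 + u / 2"
      using u(3) xy(1) by (auto simp: square_center_def field_simps)
    then have b: "- 1 \<le> b" "b < h" and a: "0 \<le> a" "a < w"
      using xy u(1,2) by linarith+
    show ?thesis
    proof (cases "b = - 1")
      case True
      then have "u = 1"
        using eq(2) xy(4) u(2) by simp
      then show ?thesis
        using a b wh True u(3) 4 square[of "a" "0"]
        by (intro disjI2 conjI exI[of _ "a"] exI[of _ "0"]) simp_all
    qed (use a b in auto)
  qed
qed

lemma plaid_transfer:
  fixes w h :: int
  assumes wh: "0 < w" "0 < h"
    and V: "\<And>a b. 0 \<le> a \<Longrightarrow> a \<le> w \<Longrightarrow> 0 \<le> b \<Longrightarrow> b < h \<Longrightarrow>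
      good p q (VEdge a b) = good p' q' (VEdge a b)"
    and H: "\<And>a b. 0 \<le> a \<Longrightarrow> a < w \<Longrightarrow> 0 \<le> b \<Longrightarrow> b \<le> h \<Longrightarrow>
      good p q (HEdge a b) = good p' q' (HEdge a b)"
    and C: "\<And>a b. 0 \<le> a \<Longrightarrow> a < w \<Longrightarrow> card {e \<in> square_edges a b. good p' q' e} \<in> {0, 2}"
  shows "({0..of_int w} \<times> {0..of_int h}) \<inter> plaid p q \<subseteq> plaid p' q'"
proof
  fix z
  assume z: "z \<in> ({0..of_int w} \<times> {0..of_int h}) \<inter> plaid p q"
  have plaidI: "z \<in> plaid p' q'"
    if "z \<in> closed_segment (square_center a b) (edge_center e)" "e \<in> square_edges a b"
      "good p' q' e" "card {e \<in> square_edges a b. good p' q' e} = 2" for a b e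
    using that unfolding plaid_def by blast
  have good_eq: "good p q e = good p' q' e"
    if "0 \<le> a" "a < w" "0 \<le> b" "b < h" "e \<in> square_edges a b" for a b e
  proof -
    have "good p q (VEdge a b) = good p' q' (VEdge a b)"
      "good p q (VEdge (a + 1) b) = good p' q' (VEdge (a + 1) b)"
      using that by (intro V; simp)+
    moreover have "good p q (HEdge a b) = good p' q' (HEdge a b)"
      "good p q (HEdge a (b + 1)) = good p' q' (HEdge a (b + 1))"
      using that by (intro H; simp)+
    ultimately show ?thesis
      using that(5) unfolding square_edges_def by blast
  qed
  from z obtain a b e where e: "z \<in> closed_segment (square_center a b) (edge_center e)"
    "card {e \<in> square_edges a b. good p q e} = 2" "e \<in> square_edges a b" "good p q e"
    unfolding plaid_def by blast
  have "z \<in> {0..of_int w} \<times> {0..of_int h}"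
    using z by (rule IntD1)
  from segment_meets_box[OF e(1,3) wh this] show "z \<in> plaid p' q'"
  proof
    assume ab: "0 \<le> a \<and> a < w \<and> 0 \<le> b \<and> b < h"
    then have "{e \<in> square_edges a b. good p q e} = {e \<in> square_edges a b. good p' q' e}"
      using good_eq[of a b] by blast
    moreover have "good p' q' e"
      using good_eq[of a b e] ab e(3,4) by blast
    ultimately show ?thesis
      using plaidI[OF e(1,3)] e(2) by simp
  next
    assume "z = edge_center e \<and> (\<exists>a b. 0 \<le> a \<and> a < w \<and> 0 \<le> b \<and> b < h \<and> e \<in> square_edges a b)"
    then obtain a b where ab: "0 \<le> a" "a < w" "0 \<le> b" "b < h"
      and e': "e \<in> square_edges a b" "z = edge_center e"
      by blast
    have good: "good p' q' e"
      using good_eq[OF ab e'(1)] e(4) by simp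
    \<comment> \<open>The touched edge is good for both parameters. Its neighbouring square inside
      the box thus has a good edge, hence two, and its polygon arc contains the touching
      point.\<close>
    have "finite {e \<in> square_edges a b. good p' q' e}"
      by (simp add: square_edges_def)
    then have "card {e \<in> square_edges a b. good p' q' e} \<noteq> 0"
      using e'(1) good by (simp only: card_0_eq) blast
    then have "card {e \<in> square_edges a b. good p' q' e} = 2"
      using C[OF ab(1,2), of b] by (metis insertE singletonD)
    then show ?thesis
      by (intro plaidI[OF _ e'(1) good]) (simp_all add: e'(2))
  qed
qed

subsection \<open>Tunes and predecessors\<close>

lemma parameterI:
  assumes "0 < p" "p < q" "coprime p q" "even (p * q)"
  shows "parameter p q"
proof -
  have "\<not> (even p \<and> even q)"
    using assms(3) not_coprimeI[of 2 p q] by auto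
  then show ?thesis
    using assms by (auto simp: parameter_def)
qed

lemma dvd_abs_less_imp_zero:
  fixes m x :: int
  assumes "m dvd x" "\<bar>x\<bar> < m"
  shows "x = 0"
  using zdvd_not_zless[of "\<bar>x\<bar>" m] assms by (meson dvd_abs_iff zero_less_abs_iff)

text \<open>Justifies the definite description. An inverse of \<open>2 * p\<close> modulo the odd
  \<open>p + q\<close> exists and can be reflected below the half; two solutions agree up to sign
  modulo \<open>p + q\<close>, and their sum is too small to be a multiple.\<close>

lemma tune_properties:
  assumes par: "parameter p q"
  shows "0 < tune p q" "2 * tune p q < p + q"
    and "[2 * p * tune p q = 1] (mod (p + q)) \<or> [2 * p * tune p q = - 1] (mod (p + q))"
proof -
  define om where "om = p + q"
  have om: "0 < om" "odd om" "1 < om"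
    using par by (auto simp: om_def parameter_def)
  define \<phi> where "\<phi> t \<longleftrightarrow> 0 < t \<and> 2 * t < om \<and> ([2 * p * t = 1] (mod om) \<or> [2 * p * t = - 1] (mod om))" for t
  have "coprime (2 * p) om"
  proof -
    have "coprime p (p + q)"
      using par by (simp add: parameter_def coprime_iff_gcd_eq_1)
    moreover have "coprime 2 om"
      using om(2) by simp
    ultimately show ?thesis
      unfolding om_def coprime_mult_left_iff by blast
  qed
  then obtain x where x: "[2 * p * x = 1] (mod om)"
    using cong_solve_coprime_int by blast
  define y where "y = x mod om"
  have "[2 * p * y = 2 * p * x] (mod om)"
    unfolding y_def by (intro cong_mult cong_refl) simp
  then have y: "[2 * p * y = 1] (mod om)"
    using x by (rule cong_trans)
  have y_bounds: "0 \<le> y" "y < om"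
    using om(1) by (simp_all add: y_def)
  have "y \<noteq> 0"
  proof
    assume "y = 0"
    then have "om dvd 1"
      using y by (simp add: cong_iff_dvd_diff)
    then show False
      using om(3) by simp
  qed
  have "\<exists>t. \<phi> t"
  proof (cases "2 * y < om")
    case True
    then show ?thesis
      using y y_bounds \<open>y \<noteq> 0\<close> unfolding \<phi>_def by (intro exI[of _ y]) auto
  next
    case False
    have "[2 * p * (om - y) = - 1] (mod om)"
      by (rule cong_via[OF cong_refl cong_minus_minus_iff[THEN iffD2, OF cong_sym[OF y]], where k = "- 2 * p"])
        (simp add: algebra_simps)
    moreover have "2 * y \<noteq> om"
      using om(2) by auto
    ultimately show ?thesis
      using False y_bounds unfolding \<phi>_def by (intro exI[of _ "om - y"]) auto
  qed
  moreover have "t = t'" if tt': "\<phi> t" "\<phi> t'" for t t'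
  proof -
    have *: "\<exists>e. (e = 1 \<or> e = - 1) \<and> om dvd 2 * p * t - e" if "\<phi> t" for t
      using that unfolding \<phi>_def cong_iff_dvd_diff by (elim conjE disjE) (blast intro: exI)+
    obtain e e' where e: "e = 1 \<or> e = - 1" "om dvd 2 * p * t - e"
      "e' = 1 \<or> e' = - 1" "om dvd 2 * p * t' - e'"
      using *[OF tt'(1)] *[OF tt'(2)] by (elim exE conjE)
    have "om dvd 2 * p * (t - t')" if "e = e'"
      using dvd_diff[OF e(2,4)] that by (simp add: algebra_simps)
    moreover have "om dvd 2 * p * (t + t')" if "e = - e'"
      using dvd_add[OF e(2,4)] that by (simp add: algebra_simps)
    ultimately have "om dvd 2 * p * (t - t') \<or> om dvd 2 * p * (t + t')"
      using e(1,3) by auto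
    then have "om dvd t - t' \<or> om dvd t + t'"
      using parameter_dvd[OF par] unfolding om_def by blast
    moreover have "\<not> om dvd t + t'"
      using that by (intro zdvd_not_zless) (auto simp: \<phi>_def)
    ultimately have "om dvd t - t'"
      by blast
    moreover have "\<bar>t - t'\<bar> < om"
      using that by (auto simp: \<phi>_def)
    ultimately have "t - t' = 0"
      by (rule dvd_abs_less_imp_zero)
    then show ?thesis
      by simp
  qed
  ultimately have "\<exists>!t. \<phi> t"
    by blast
  then have "\<phi> (THE t. \<phi> t)"
    by (rule theI')
  moreover have "real_of_int t < real_of_int (p + q) / 2 \<longleftrightarrow> 2 * t < om" for t
  proof -
    have "real_of_int t < real_of_int (p + q) / 2 \<longleftrightarrow> real_of_int (2 * t) < of_int om"
      unfolding om_def by auto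
    then show ?thesis
      by (simp only: of_int_less_iff)
  qed
  then have "(THE t. \<phi> t) = tune p q"
    unfolding tune_def \<phi>_def by (simp only: om_def)
  ultimately have "\<phi> (tune p q)"
    by simp
  then show "0 < tune p q" "2 * tune p q < p + q"
    "[2 * p * tune p q = 1] (mod (p + q)) \<or> [2 * p * tune p q = - 1] (mod (p + q))"
    unfolding \<phi>_def om_def by blast+
qed

text \<open>With \<open>p + q = s + 2 * t\<close> the defining inequalities become
  \<open>k * s \<le> t < (k + 1) * s\<close>, so \<open>kappa\<close> is the quotient
  \<open>t div s\<close>, and its vanishing means \<open>t < s\<close>.\<close>

lemma kappa_zero:
  assumes par: "parameter p q" and "kappa p q = 0"
  shows "3 * tune p q < p + q"
proof -
  define t where "t = tune p q"
  define s where "s = p + q - 2 * t"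
  have st: "0 < s" "0 < t" "p + q = s + 2 * t"
    using tune_properties[OF par] by (auto simp: s_def t_def)
  have iff: "(real k / (2 * real k + 1) \<le> real_of_int t / real_of_int (p + q) \<and>
      real_of_int t / real_of_int (p + q) < (real k + 1) / (2 * (real k + 1) + 1)) \<longleftrightarrow>
      int k = t div s" for k
  proof -
    have om: "real_of_int (p + q) = of_int s + 2 * of_int t"
      unfolding st(3) by simp
    have pos: "0 < real_of_int s + 2 * of_int t" "0 < 2 * real k + 1" "0 < 2 * (real k + 1) + 1"
      using st by simp_all
    have "real k / (2 * real k + 1) \<le> real_of_int t / real_of_int (p + q) \<longleftrightarrow>
        real k * of_int s \<le> of_int t"
      unfolding om using pos by (simp add: divide_le_eq le_divide_eq) (simp add: field_simps)
    also have "\<dots> \<longleftrightarrow> real_of_int (int k * s) \<le> of_int t"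
      by simp
    also have "\<dots> \<longleftrightarrow> int k * s \<le> t"
      by (simp only: of_int_le_iff)
    finally have 1: "real k / (2 * real k + 1) \<le> real_of_int t / real_of_int (p + q) \<longleftrightarrow>
        int k * s \<le> t" .
    have "real_of_int t / real_of_int (p + q) < (real k + 1) / (2 * (real k + 1) + 1) \<longleftrightarrow>
        of_int t < (real k + 1) * of_int s"
      unfolding om using pos by (simp add: divide_less_eq less_divide_eq) (simp add: field_simps)
    also have "\<dots> \<longleftrightarrow> real_of_int t < of_int ((int k + 1) * s)"
      by simp
    also have "\<dots> \<longleftrightarrow> t < (int k + 1) * s"
      by (simp only: of_int_less_iff)
    finally have 2: "real_of_int t / real_of_int (p + q) < (real k + 1) / (2 * (real k + 1) + 1) \<longleftrightarrow>
        t < (int k + 1) * s" .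
    have "int k * s \<le> t \<and> t < (int k + 1) * s \<longleftrightarrow> int k = t div s"
    proof
      assume "int k * s \<le> t \<and> t < (int k + 1) * s"
      then have "t div s = int k"
        by (intro int_div_pos_eq[of t s "int k" "t - int k * s"]) (simp_all add: algebra_simps)
      then show "int k = t div s" ..
    next
      assume "int k = t div s"
      then show "int k * s \<le> t \<and> t < (int k + 1) * s"
        using div_interval[OF st(1), of t] by (simp only: mult.commute[of s])
    qed
    then show ?thesis
      unfolding 1 2 .
  qed
  have "0 \<le> t div s"
    using st by (simp add: pos_imp_zdiv_nonneg_iff)
  then have "kappa p q = nat (t div s)"
    unfolding kappa_def t_def[symmetric] iff by (intro the_equality) auto
  then have "t div s = 0"
    using assms(2) \<open>0 \<le> t div s\<close> by simp
  then show ?thesis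
    using div_interval[OF st(1), of t] by (simp add: s_def t_def)
qed

lemma even_parameter_parameter: "even_parameter p q \<Longrightarrow> parameter p q"
  unfolding even_parameter_def even_rational_def by (blast intro: parameterI)

text \<open>Modulo \<open>om\<close> the determinant condition gives that \<open>om'\<close> is
  \<open>2 * t\<close> or \<open>- 2 * t\<close>, with \<open>t\<close> the tune of
  \<open>p/q\<close>. Size and oddness leave \<open>om' = om - 2 * t\<close>, and
  \<open>kappa_zero\<close> turns this into \<open>om < 3 * om'\<close>.\<close>

lemma even_predecessor_facts:
  assumes par: "parameter p q" and "kappa p q = 0" and pred: "even_predecessor p' q' p q"
  shows "parameter p' q'" "p + q < 3 * (p' + q')" "p' + q' < p + q"
proof -
  define om where "om = p + q"
  define om' where "om' = p' + q'"
  define d where "d = p * q' - p' * q"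
  define t where "t = tune p q"
  have om: "0 < om" "odd om" "0 < p" "p < q" "3 \<le> om"
    using par by (auto simp: parameter_def om_def)
  have q': "0 < q'" "coprime p' q'" "even (p' * q')" and d: "\<bar>d\<bar> = 1" and less: "om' < om"
    using pred by (auto simp: even_predecessor_def even_rational_def d_def om_def om'_def)
  show "p' + q' < p + q"
    using less by (simp add: om_def om'_def)
  have t: "0 < t" "3 * t < om"
    using tune_properties[OF par] kappa_zero[OF par assms(2)] by (simp_all add: t_def om_def)
  obtain e where e: "e = 1 \<or> e = - 1" "om dvd 2 * p * t - e"
    using tune_properties(3)[OF par] unfolding t_def om_def cong_iff_dvd_diff by (elim disjE) blast+
  have "0 \<le> p'"
  proof (rule ccontr)
    assume "\<not> 0 \<le> p'"
    then have "q * 1 \<le> q * (- p')"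
      using om by (intro mult_left_mono) auto
    moreover have "0 < p * q'"
      using om q' by simp
    ultimately have "1 < d"
      using om by (simp add: d_def algebra_simps)
    then show False
      using d by simp
  qed
  have "odd om'"
    using q'(2,3) coprime_common_divisor[OF q'(2), of 2] by (auto simp: om'_def)
  have "om' > 0"
    using q'(1) \<open>0 \<le> p'\<close> by (simp add: om'_def)
  have "om dvd 2 * p * om' - 2 * d"
  proof -
    have "2 * p * om' - 2 * d = om * (2 * p')"
      by (simp add: om_def om'_def d_def algebra_simps)
    then show ?thesis
      by simp
  qed
  \<comment> \<open>The multiplier \<open>2 * (d * e)\<close> is chosen so that
    \<open>e * e = 1\<close> cancels the constant \<open>2 * d\<close>.\<close>
  then have "om dvd (2 * p * om' - 2 * d) - 2 * (d * e) * (2 * p * t - e)"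
    by (rule dvd_diff[OF _ dvd_mult[OF e(2)]])
  moreover have "d * e * e = d"
    using e(1) by auto
  then have "(2 * p * om' - 2 * d) - 2 * (d * e) * (2 * p * t - e) = 2 * p * (om' - 2 * (d * e) * t)"
    by (simp add: algebra_simps)
  ultimately have dvd: "om dvd om' - 2 * (d * e) * t"
    using parameter_dvd[OF par] unfolding om_def by metis
  have om': "om' = om - 2 * t"
  proof -
    have "d * e = 1 \<or> d * e = - 1"
      using d e(1) by (auto simp: abs_if split: if_splits)
    then show ?thesis
    proof
      assume "d * e = 1"
      then have "om dvd om' - 2 * t"
        using dvd by simp
      moreover have "\<bar>om' - 2 * t\<bar> < om"
        using less t \<open>0 < om'\<close> by linarith
      ultimately have "om' - 2 * t = 0"
        by (rule dvd_abs_less_imp_zero)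
      then show ?thesis
        using \<open>odd om'\<close> by auto
    next
      assume "d * e = - 1"
      then have "om dvd om' + 2 * t - om"
        using dvd by simp
      moreover have "\<bar>om' + 2 * t - om\<bar> < om"
        using less t \<open>0 < om'\<close> by linarith
      ultimately have "om' + 2 * t - om = 0"
        by (rule dvd_abs_less_imp_zero)
      then show ?thesis
        by simp
    qed
  qed
  then have "om < 3 * om'"
    using t by simp
  then show "p + q < 3 * (p' + q')"
    by (simp add: om_def om'_def)
  \<comment> \<open>The predecessor \<open>0/1\<close> has \<open>om' = 1\<close>, which
    \<open>3 \<le> om < 3 * om'\<close> excludes.\<close>
  have "p' \<noteq> 0"
  proof
    assume "p' = 0"
    then have "q' = 1"
      using q'(1,2) by simp
    then show False
      using \<open>om < 3 * om'\<close> om(5) \<open>p' = 0\<close> by (simp add: om'_def)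
  qed
  have "p' \<noteq> q'"
    using \<open>odd om'\<close> by (auto simp: om'_def)
  have "p' < q'"
  proof (rule ccontr)
    assume "\<not> p' < q'"
    then have "(q' + 1) * q \<le> p' * q"
      using \<open>p' \<noteq> q'\<close> om by (intro mult_right_mono) auto
    moreover have "p * q' \<le> q * q'"
      using om q' by (intro mult_right_mono) auto
    ultimately have "d \<le> - q"
      by (simp add: d_def algebra_simps)
    then show False
      using d om by simp
  qed
  then show "parameter p' q'"
    using \<open>0 \<le> p'\<close> \<open>p' \<noteq> 0\<close> q' by (intro parameterI) auto
qed

text \<open>Modulo \<open>om'\<close> the determinant makes \<open>om\<close> congruent to
  \<open>2 * t\<close> or \<open>- 2 * t\<close>, with \<open>t\<close> now the tune of
  \<open>p'/q'\<close>. Since \<open>om\<close> is odd and lies between \<open>om'\<close> and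
  \<open>3 * om'\<close>, each sign leaves a single value.\<close>

lemma copying_intro:
  assumes par: "parameter p q" and par': "parameter p' q'"
    and det: "\<bar>p * q' - p' * q\<bar> = 1" and less: "p' + q' < p + q" "p + q < 3 * (p' + q')"
    and t: "t = tune p' q'" and w: "w = min t (p' + q' - 2 * t)"
  obtains (weak) "p + q = p' + q' + 2 * t"
      "copying p q p' q' (p * q' - p' * q) t w (p' + q' - w) (p' + q' + t) (p + q) (p' + q')"
    | (strong) "p + q = 3 * (p' + q') - 2 * t"
      "copying p q p' q' (p * q' - p' * q) t w (p' + q') (2 * (p' + q') - t) (p + q) (p' + q')"
proof -
  define om where "om = p + q"
  define om' where "om' = p' + q'"
  define d where "d = p * q' - p' * q"
  have odd: "odd om" "odd om'"
    using par par' by (auto simp: parameter_def om_def om'_def)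
  have tb: "0 < t" "2 * t < om'"
    using tune_properties[OF par'] by (simp_all add: t om'_def)
  then have w': "0 < w" "w \<le> t" "w \<le> om' - 2 * t"
    by (auto simp: w om'_def)
  have d: "d = 1 \<or> d = - 1"
    using det by (auto simp: d_def abs_if split: if_splits)
  have det': "p * om' - p' * om = d"
    by (simp add: om_def om'_def d_def algebra_simps)
  have "2 * p' * om + 2 * d = om' * (2 * p)"
    using det' by (simp add: algebra_simps)
  then have om_dvd: "om' dvd 2 * p' * om + 2 * d"
    by simp
  obtain e where e: "e = 1 \<or> e = - 1" "[2 * p' * t = e] (mod om')"
    using tune_properties(3)[OF par'] unfolding t om'_def by blast
  have e_dvd: "om' dvd 2 * (2 * p' * t - e)"
    using e(2) by (intro dvd_mult) (simp only: cong_iff_dvd_diff)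
  have om_less: "om' < om" "om < 3 * om'"
    using less by (simp_all add: om_def om'_def)
  have "e = - d \<or> e = d"
    using e(1) d by auto
  then show thesis
  proof
    assume ed: "e = - d"
    have "om' dvd (2 * p' * om + 2 * d) - 2 * (2 * p' * t - e)"
      using om_dvd e_dvd by (rule dvd_diff)
    moreover have "(2 * p' * om + 2 * d) - 2 * (2 * p' * t - e) = 2 * p' * (om - 2 * t)"
      unfolding ed by (simp add: algebra_simps)
    ultimately have "om' dvd om - 2 * t"
      using parameter_dvd[OF par'] unfolding om'_def by metis
    then obtain k where k: "om - 2 * t = om' * k" ..
    have "0 < om' * k" "om' * k < om' * 3"
      using k tb om_less by linarith+
    then have "0 < k" "k < 3"
      using tb by (simp_all add: zero_less_mult_iff)
    moreover have "odd (om' * k)"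
      unfolding k[symmetric] using odd by simp
    then have "k \<noteq> 2"
      by auto
    ultimately have "k = 1"
      by linarith
    then have om: "om = om' + 2 * t"
      using k by simp
    have "copying p q p' q' d t w (om' - w) (om' + t) om om'"
      using par par' d det' w' om e(2) ed by unfold_locales (simp_all add: om_def om'_def)
    then show thesis
      using weak om by (simp add: om_def om'_def d_def)
  next
    assume ed: "e = d"
    have "om' dvd (2 * p' * om + 2 * d) + 2 * (2 * p' * t - e)"
      using om_dvd e_dvd by (rule dvd_add)
    moreover have "(2 * p' * om + 2 * d) + 2 * (2 * p' * t - e) = 2 * p' * (om + 2 * t)"
      unfolding ed by (simp add: algebra_simps)
    ultimately have "om' dvd om + 2 * t"
      using parameter_dvd[OF par'] unfolding om'_def by metis
    then obtain k where k: "om + 2 * t = om' * k" ..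
    have "om' * 1 < om' * k" "om' * k < om' * 4"
      using k tb om_less by linarith+
    then have "1 < k" "k < 4"
      using tb by (simp_all only: mult_less_cancel_left_pos)
    moreover have "odd (om' * k)"
      unfolding k[symmetric] using odd by simp
    then have "k \<noteq> 2"
      by auto
    ultimately have "k = 3"
      by linarith
    then have om: "om = 3 * om' - 2 * t"
      using k by simp
    have "copying p q p' q' d t w om' (2 * om' - t) om om'"
      using par par' d det' w' om e(2) ed by unfold_locales (simp_all add: om_def om'_def)
    then show thesis
      using strong om by (simp add: om_def om'_def d_def)
  qed
qed

lemma (in copying) plaid_agree:
  "({0..of_int w} \<times> {0..of_int h}) \<inter> plaid p' q' = ({0..of_int w} \<times> {0..of_int h}) \<inter> plaid p q"
proof -
  have h: "0 < h"
    using w bounds(6) by linarith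
  have C: "card {e \<in> square_edges a b. good p q e} \<in> {0, 2}"
    "card {e \<in> square_edges a b. good p' q' e} \<in> {0, 2}" if "0 \<le> a" "a < w" for a b
    using card_good_square[OF par that(1), of b] card_good_square[OF par' that(1), of b]
      that bounds(1,9) om om' by linarith+
  have "({0..of_int w} \<times> {0..of_int h}) \<inter> plaid p q \<subseteq> plaid p' q'"
    by (rule plaid_transfer[OF w(1) h good_V_transfer good_H_transfer C(2)])
  moreover have "({0..of_int w} \<times> {0..of_int h}) \<inter> plaid p' q' \<subseteq> plaid p q"
    by (rule plaid_transfer[OF w(1) h good_V_transfer[symmetric] good_H_transfer[symmetric] C(1)])
  ultimately show ?thesis
    by blast
qed

theorem lemma6p1:
  fixes p q p' q' \<omega> \<omega>' \<tau>' w :: int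
    and R S S' :: "(real \<times> real) set"
  assumes "even_parameter p q"
    and "kappa p q = 0"
    and "even_predecessor p' q' p q"
    and "\<omega> = p + q"
    and "\<omega>' = p' + q'"
    and "\<tau>' = tune p' q'"
    and "w = min \<tau>' (\<omega>' - 2 * \<tau>')"
    and "R = {0..real_of_int w} \<times> {0..real_of_int \<omega>'}"
    and "2 * \<omega>' > \<omega> \<Longrightarrow> S' = {(x, y) \<in> R. y \<le> real_of_int (\<omega>' - w)}"
    and "2 * \<omega>' < \<omega> \<Longrightarrow> S' = R"
    and "S = S'"
  shows "S' \<inter> plaid p' q' = S \<inter> plaid p q"
proof -
  have par: "parameter p q"
    using assms(1) by (rule even_parameter_parameter)
  note pred = even_predecessor_facts[OF par assms(2,3)]
  have det: "\<bar>p * q' - p' * q\<bar> = 1"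
    using assms(3) by (simp add: even_predecessor_def)
  have tau: "0 < \<tau>'" "2 * \<tau>' < \<omega>'"
    using tune_properties[OF pred(1)] assms(5,6) by simp_all
  \<comment> \<open>Because \<open>2 * \<tau>' < \<omega>'\<close>, the value
    \<open>\<omega>' + 2 * \<tau>'\<close> lies below \<open>2 * \<omega>'\<close> and
    \<open>3 * \<omega>' - 2 * \<tau>'\<close> above it, so the two cases match those defining
    \<open>S'\<close>.\<close>
  from par pred(1) det pred(3,2) assms(6) assms(7)[unfolded assms(5)] show ?thesis
  proof (cases rule: copying_intro)
    case weak
    have "2 * \<omega>' > \<omega>"
      using weak(1) tau assms(4,5) by linarith
    then have "S' = {(x, y) \<in> R. y \<le> real_of_int (\<omega>' - w)}"
      by (rule assms(9))
    also have "\<dots> = {0..of_int w} \<times> {0..of_int (p' + q' - w)}"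
      using tau unfolding assms(5,7,8) by auto
    finally show ?thesis
      using copying.plaid_agree[OF weak(2)] unfolding assms(11) by simp
  next
    case strong
    have "2 * \<omega>' < \<omega>"
      using strong(1) tau(2) unfolding assms(4,5) by simp
    then have "S' = R"
      by (rule assms(10))
    then show ?thesis
      using copying.plaid_agree[OF strong(2)] unfolding assms(5,8,11) by simp
  qed
qed

end
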